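(* Let $(X,d)$ be a compact metric space and let $\sigma_0,\dots,\sigma_{N-1}:X\to X$ be maps such that for each $0\le i\le N-1$ there is $0<r_i<1$ with $d(\sigma_i(x),\sigma_i(y))\le r_i\,d(x,y)$ for all $x,y\in X$. Assume that there is a Borel measurable $\sigma:X\to X$ with $\sigma\circ\sigma_i=\mathrm{id}_X$ for all $i$, and that $X=\bigcup_{i=0}^{N-1}\sigma_i(X)$, a disjoint union. Let $\mathcal{H}$ be a Hilbert space with bounded operators $S_0,\dots,S_{N-1}$ on $\mathcal{H}$ satisfying the Cuntz relations $S_i^*S_j=\delta_{i,j}\,\mathrm{id}_{\mathcal{H}}$ for $0\le i,j\le N-1$ and $\sum_{i=0}^{N-1}S_iS_i^*=\mathrm{id}_{\mathcal{H}}$. Let $P(X)$ be the collection of all projection-valued measures from the Borel subsets $\mathcal{B}(X)$ of $X$ into the projections on $\mathcal{H}$, with the metric $$\rho(E,F)=\sup_{\phi\in \mathrm{Lip}_1(X)}\left\|\int\phi\,dE-\int\phi\,dF\right\|,$$ where $\|\cdot\|$ is the operator norm on $\mathcal{B}(\mathcal{H})$. Then the map $\Phi:P(X)\to P(X)$ given by $$\Phi(E)(\cdot)=\sum_{i=0}^{N-1}S_iE(\sigma_i^{-1}(\cdot))S_i^*$$ is (well defined and) a Lipschitz contraction in the $\rho$ metric.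
   Context: A Lipschitz contraction on a metric space $(Y,\rho)$ is a map $\Phi:Y\to Y$ for which there is a constant $0<r<1$ with $\rho(\Phi(a),\Phi(b))\le r\rho(a,b)$ for all $a,b\in Y$. $\mathcal{B}(\mathcal{H})$ denotes the bounded operators on the (complex) Hilbert space $\mathcal{H}$. A projection-valued measure $F:\mathcal{B}(X)\to\mathcal{B}(\mathcal{H})$ assigns to each Borel set an orthogonal projection, with $F(\emptyset)=0$, $F(X)=\mathrm{id}_{\mathcal{H}}$, $F(\Delta_1\cap\Delta_2)=F(\Delta_1)F(\Delta_2)$, and countable additivity (in the strong operator topology) on disjoint sequences of Borel sets. For $g,h\in\mathcal{H}$, $F_{g,h}(\Delta)=\langle F(\Delta)g,h\rangle$ is a countably additive complex measure. For a bounded Borel function $\psi:X\to\mathbb{C}$, $\int\psi\,dF$ is the unique bounded operator with $\langle(\int\psi\,dF)g,h\rangle=\int_X\psi\,dF_{g,h}$ for all $g,h\in\mathcal{H}$. $\mathrm{Lip}_1(X)=\{\phi:X\to\mathbb{R}: |\phi(x)-\phi(y)|\le d(x,y)\text{ for all }x,y\in X\}$. *)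

theory Defs
  imports "HOL-Analysis.Analysis"
begin

text \<open>
  The inner product is linear in the \<^emph>\<open>first\<close> argument; this is forced by the requirement
  \<open>\<langle>(\<integral>\<psi> dF) g, h\<rangle> = \<integral>\<psi> dF\<^bsub>g,h\<^esub>\<close> with \<open>F\<^bsub>g,h\<^esub>(\<Delta>) = \<langle>F(\<Delta>) g, h\<rangle>\<close>. Positive definiteness is
  contained in the last axiom, since \<open>norm\<close> is a norm.
\<close>

class complex_inner = real_normed_vector +
  fixes scaleC :: "complex \<Rightarrow> 'a \<Rightarrow> 'a"  (infixr "*\<^sub>C" 75)
    and cinner :: "'a \<Rightarrow> 'a \<Rightarrow> complex"
  assumes scaleC_of_real: "complex_of_real r *\<^sub>C x = r *\<^sub>R x"
    and scaleC_add_right: "c *\<^sub>C (x + y) = c *\<^sub>C x + c *\<^sub>C y"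
    and scaleC_add_left: "(b + c) *\<^sub>C x = b *\<^sub>C x + c *\<^sub>C x"
    and scaleC_scaleC: "b *\<^sub>C c *\<^sub>C x = (b * c) *\<^sub>C x"
    and cinner_commute: "cinner x y = cnj (cinner y x)"
    and cinner_add_left: "cinner (x + y) z = cinner x z + cinner y z"
    and cinner_scaleC_left: "cinner (c *\<^sub>C x) y = c * cinner x y"
    and norm_eq_sqrt_cinner: "norm x = sqrt (Re (cinner x x))"

class complex_hilbert = complex_inner + complete_space

text \<open>
  The type of bounded real-linear maps carries the operator norm; bounded operators on the
  complex space are its complex-linear elements.
\<close>

definition bounded_operators :: "('h::complex_inner \<Rightarrow>\<^sub>L 'h) set" where
  "bounded_operators = {T. \<forall>c x. blinfun_apply T (c *\<^sub>C x) = c *\<^sub>C blinfun_apply T x}"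

definition adj :: "('h::complex_hilbert \<Rightarrow>\<^sub>L 'h) \<Rightarrow> ('h \<Rightarrow>\<^sub>L 'h)" where
  "adj T = (THE T'. T' \<in> bounded_operators \<and>
     (\<forall>x y. cinner (blinfun_apply T x) y = cinner x (blinfun_apply T' y)))"

definition projections :: "('h::complex_hilbert \<Rightarrow>\<^sub>L 'h) set" where
  "projections = {P \<in> bounded_operators. P o\<^sub>L P = P \<and> adj P = P}"

text \<open>
  A projection-valued measure has the Borel sets as its domain, so it is taken to be
  \<^const>\<open>undefined\<close> outside them. Countable additivity is with respect to the strong operator
  topology.
\<close>

definition projection_valued_measures ::
    "('x::topological_space set \<Rightarrow> ('h::complex_hilbert \<Rightarrow>\<^sub>L 'h)) set" where
  "projection_valued_measures =
     {F \<in> sets borel \<rightarrow>\<^sub>E projections.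
        F {} = 0 \<and> F UNIV = id_blinfun \<and>
        (\<forall>A\<in>sets borel. \<forall>B\<in>sets borel. F (A \<inter> B) = F A o\<^sub>L F B) \<and>
        (\<forall>A::nat \<Rightarrow> 'x set. range A \<subseteq> sets borel \<longrightarrow> disjoint_family A \<longrightarrow>
           (\<forall>g. (\<lambda>n. blinfun_apply (F (A n)) g) sums blinfun_apply (F (\<Union>n. A n)) g))}"

text \<open>
  Integration against a complex measure \<open>\<mu>\<close> on the sets of \<open>M\<close>, by the Jordan decompositions of
  its real and imaginary parts. For a signed measure \<open>\<nu>\<close> the positive variation is
  \<open>\<nu>\<^sup>+(A) = sup {\<nu>(B) | B \<subseteq> A}\<close> and \<open>\<nu>\<^sup>- = (-\<nu>)\<^sup>+\<close>. That \<^const>\<open>ennreal\<close> truncates negative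
  numbers is harmless, as \<open>B = {}\<close> contributes \<open>0\<close>.
\<close>

definition positive_variation :: "'a measure \<Rightarrow> ('a set \<Rightarrow> real) \<Rightarrow> 'a measure" where
  "positive_variation M \<nu> =
     measure_of (space M) (sets M) (\<lambda>A. SUP B\<in>{B \<in> sets M. B \<subseteq> A}. ennreal (\<nu> B))"

definition signed_measure_integral ::
    "'a measure \<Rightarrow> ('a set \<Rightarrow> real) \<Rightarrow> ('a \<Rightarrow> complex) \<Rightarrow> complex" where
  "signed_measure_integral M \<nu> \<psi> =
     (\<integral>x. \<psi> x \<partial>positive_variation M \<nu>) - (\<integral>x. \<psi> x \<partial>positive_variation M (\<lambda>A. - \<nu> A))"

definition complex_measure_integral ::
    "'a measure \<Rightarrow> ('a set \<Rightarrow> complex) \<Rightarrow> ('a \<Rightarrow> complex) \<Rightarrow> complex" where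
  "complex_measure_integral M \<mu> \<psi> =
     signed_measure_integral M (\<lambda>A. Re (\<mu> A)) \<psi> + \<i> * signed_measure_integral M (\<lambda>A. Im (\<mu> A)) \<psi>"

definition pvm_integral ::
    "('x::topological_space set \<Rightarrow> ('h::complex_hilbert \<Rightarrow>\<^sub>L 'h)) \<Rightarrow> ('x \<Rightarrow> complex) \<Rightarrow> ('h \<Rightarrow>\<^sub>L 'h)" where
  "pvm_integral F \<psi> = (THE T. T \<in> bounded_operators \<and>
     (\<forall>g h. cinner (blinfun_apply T g) h =
        complex_measure_integral borel (\<lambda>\<Delta>. cinner (blinfun_apply (F \<Delta>) g) h) \<psi>))"

definition Lip1 :: "('x::metric_space \<Rightarrow> real) set" where
  "Lip1 = {\<phi>. \<forall>x y. \<bar>\<phi> x - \<phi> y\<bar> \<le> dist x y}"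

text \<open>
  On a compact space the supremum below is over a bounded set: a constant added to \<open>\<phi>\<close> cancels
  in the difference, so one may take \<open>\<bar>\<phi>\<bar>\<close> to be at most the diameter.
\<close>

definition pvm_dist ::
    "('x::metric_space set \<Rightarrow> ('h::complex_hilbert \<Rightarrow>\<^sub>L 'h)) \<Rightarrow> ('x set \<Rightarrow> ('h \<Rightarrow>\<^sub>L 'h)) \<Rightarrow> real" where
  "pvm_dist E F = (SUP \<phi>\<in>Lip1.
     norm (pvm_integral E (\<lambda>x. complex_of_real (\<phi> x)) - pvm_integral F (\<lambda>x. complex_of_real (\<phi> x))))"

definition lipschitz_contraction :: "'a set \<Rightarrow> ('a \<Rightarrow> 'a \<Rightarrow> real) \<Rightarrow> ('a \<Rightarrow> 'a) \<Rightarrow> bool" where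
  "lipschitz_contraction Y \<rho> \<Phi> \<longleftrightarrow>
     \<Phi> \<in> Y \<rightarrow> Y \<and> (\<exists>r. 0 < r \<and> r < 1 \<and> (\<forall>a\<in>Y. \<forall>b\<in>Y. \<rho> (\<Phi> a) (\<Phi> b) \<le> r * \<rho> a b))"

definition cuntz_relations :: "nat \<Rightarrow> (nat \<Rightarrow> ('h::complex_hilbert \<Rightarrow>\<^sub>L 'h)) \<Rightarrow> bool" where
  "cuntz_relations N S \<longleftrightarrow>
     (\<forall>i<N. \<forall>j<N. adj (S i) o\<^sub>L S j = (if i = j then id_blinfun else 0)) \<and>
     (\<Sum>i<N. S i o\<^sub>L adj (S i)) = id_blinfun"

definition pvm_map ::
    "nat \<Rightarrow> (nat \<Rightarrow> 'x \<Rightarrow> 'x) \<Rightarrow> (nat \<Rightarrow> ('h::complex_hilbert \<Rightarrow>\<^sub>L 'h)) \<Rightarrow>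
     ('x::topological_space set \<Rightarrow> ('h \<Rightarrow>\<^sub>L 'h)) \<Rightarrow> ('x set \<Rightarrow> ('h \<Rightarrow>\<^sub>L 'h))" where
  "pvm_map N \<sigma> S E =
     (\<lambda>\<Delta>\<in>sets borel. \<Sum>i<N. S i o\<^sub>L E (\<sigma> i -` \<Delta>) o\<^sub>L adj (S i))"

end

theory Submission
  imports Defs
begin

text \<open>
  For a projection-valued measure \<open>E\<close>, polarization expresses the complex measures \<open>E\<^bsub>g,h\<^esub>\<close> through the
  positive measures \<open>\<parallel>E(\<cdot>) g\<parallel>\<^sup>2\<close>, so \<open>\<integral>\<phi> dE\<close> with \<open>\<phi>\<close> real is the operator \<open>T\<close> with
  \<open>\<langle>Tg, g\<rangle> = \<integral>\<phi> d\<parallel>E(\<cdot>) g\<parallel>\<^sup>2\<close> for all \<open>g\<close>. Such a \<open>T\<close> has norm at most \<open>sup \<bar>\<phi>\<bar>\<close>, which gives its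
  existence as a limit of integrals of simple functions. The image measure satisfies
  \<open>\<parallel>\<Phi>(E)(\<Delta>) g\<parallel>\<^sup>2 = \<Sum>\<^sub>i \<parallel>E(\<sigma>\<^sub>i\<^sup>-\<^sup>1 \<Delta>) S\<^sub>i\<^sup>* g\<parallel>\<^sup>2\<close>, whence \<open>\<integral>\<phi> d\<Phi>(E) = \<Sum>\<^sub>i S\<^sub>i (\<integral>\<phi> \<circ> \<sigma>\<^sub>i dE) S\<^sub>i\<^sup>*\<close>. By the Cuntz
  relations the norm of \<open>\<Sum>\<^sub>i S\<^sub>i A\<^sub>i S\<^sub>i\<^sup>*\<close> is at most \<open>max \<parallel>A\<^sub>i\<parallel>\<close>, and \<open>\<phi> \<circ> \<sigma>\<^sub>i\<close> is \<open>r\<^sub>i\<close>-Lipschitz; so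
  \<open>\<Phi>\<close> contracts by \<open>max r\<^sub>i\<close>.
\<close>

section \<open>Complex Hilbert spaces\<close>

instance complex_hilbert \<subseteq> banach ..

section \<open>Sesquilinearity, the norm and the Cauchy-Schwarz inequality\<close>

lemma scaleC_zero_right [simp]: "c *\<^sub>C 0 = (0::'a::complex_inner)"
  using scaleC_add_right[of c "0::'a" 0] by simp

lemma scaleC_scaleR: "c *\<^sub>C r *\<^sub>R x = r *\<^sub>R c *\<^sub>C (x::'a::complex_inner)"
  by (simp flip: scaleC_of_real add: scaleC_scaleC mult.commute)

lemma cinner_scaleR_left: "cinner (r *\<^sub>R x) y = of_real r * cinner (x::'a::complex_inner) y"
  by (simp flip: scaleC_of_real add: cinner_scaleC_left)

lemma cinner_zero_left [simp]: "cinner 0 (y::'a::complex_inner) = 0"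
  using cinner_scaleR_left[of 0 0 y] by simp

lemma cinner_minus_left: "cinner (- x) y = - cinner (x::'a::complex_inner) y"
  using cinner_scaleR_left[of "-1" x y] by simp

lemma cinner_diff_left: "cinner (x - y) z = cinner (x::'a::complex_inner) z - cinner y z"
  using cinner_add_left[of x "- y" z] by (simp add: cinner_minus_left)

lemma cinner_add_right: "cinner x (y + z) = cinner (x::'a::complex_inner) y + cinner x z"
  by (metis cinner_add_left cinner_commute complex_cnj_add)

lemma cinner_scaleC_right: "cinner x (c *\<^sub>C y) = cnj c * cinner (x::'a::complex_inner) y"
  by (metis cinner_commute cinner_scaleC_left complex_cnj_mult)

lemma cinner_scaleR_right: "cinner x (r *\<^sub>R y) = of_real r * cinner (x::'a::complex_inner) y"
  by (simp flip: scaleC_of_real add: cinner_scaleC_right)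

lemma cinner_zero_right [simp]: "cinner (y::'a::complex_inner) 0 = 0"
  using cinner_scaleR_right[of y 0 0] by simp

lemma cinner_minus_right: "cinner x (- y) = - cinner (x::'a::complex_inner) y"
  using cinner_scaleR_right[of x "-1" y] by simp

lemma cinner_diff_right: "cinner x (y - z) = cinner (x::'a::complex_inner) y - cinner x z"
  using cinner_add_right[of x y "- z"] by (simp add: cinner_minus_right)

lemma cinner_sum_left: "cinner (\<Sum>i\<in>A. f i) y = (\<Sum>i\<in>A. cinner (f i) (y::'a::complex_inner))"
  by (induction A rule: infinite_finite_induct) (auto simp: cinner_add_left)

lemma cinner_sum_right: "cinner y (\<Sum>i\<in>A. f i) = (\<Sum>i\<in>A. cinner (y::'a::complex_inner) (f i))"
  by (induction A rule: infinite_finite_induct) (auto simp: cinner_add_right)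

lemma cinner_self: "cinner x x = of_real ((norm (x::'a::complex_inner))\<^sup>2)"
proof -
  have "Im (cinner x x) = 0"
    using cinner_commute[of x x] by (simp add: complex_eq_iff)
  \<comment> \<open>The real function \<open>sqrt\<close> is negative on negative numbers, so a
    nonnegative norm forces the radicand to be nonnegative.\<close>
  moreover have "0 \<le> Re (cinner x x)"
    using norm_eq_sqrt_cinner[of x] norm_ge_zero[of x] by (metis real_sqrt_ge_0_iff)
  ultimately show ?thesis
    by (simp add: complex_eq_iff norm_eq_sqrt_cinner[of x])
qed

lemma Re_cinner_commute: "Re (cinner y x) = Re (cinner (x::'a::complex_inner) y)"
  using cinner_commute[of x y] by simp

lemma norm_add_sq:
  "(norm (x + y))\<^sup>2 = (norm (x::'a::complex_inner))\<^sup>2 + 2 * Re (cinner x y) + (norm y)\<^sup>2"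
proof -
  have "cinner (x + y) (x + y) = cinner x x + cinner x y + cinner y x + cinner y y"
    by (simp add: cinner_add_left cinner_add_right)
  from arg_cong[OF this, of Re] show ?thesis
    by (simp add: cinner_self Re_cinner_commute)
qed

lemma norm_diff_sq:
  "(norm (x - y))\<^sup>2 = (norm (x::'a::complex_inner))\<^sup>2 - 2 * Re (cinner x y) + (norm y)\<^sup>2"
  using norm_add_sq[of x "- y"] by (simp add: cinner_minus_right)

lemma norm_scaleC: "norm (c *\<^sub>C x) = cmod c * norm (x::'a::complex_inner)"
proof -
  have "cinner (c *\<^sub>C x) (c *\<^sub>C x) = (c * cnj c) * cinner x x"
    by (simp add: cinner_scaleC_left cinner_scaleC_right)
  also have "\<dots> = of_real ((cmod c * norm x)\<^sup>2)"
    by (simp only: cinner_self complex_norm_square[symmetric] of_real_mult of_real_power power_mult_distrib)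
  finally have "cinner (c *\<^sub>C x) (c *\<^sub>C x) = of_real ((cmod c * norm x)\<^sup>2)" .
  then have "(norm (c *\<^sub>C x))\<^sup>2 = (cmod c * norm x)\<^sup>2"
    by (metis cinner_self of_real_eq_iff)
  then show ?thesis by simp
qed

lemma Re_cinner_le: "Re (cinner x y) \<le> norm (x::'a::complex_inner) * norm y"
proof (cases "x = 0 \<or> y = 0")
  case False
  \<comment> \<open>The weights give both scaled vectors the length \<open>norm x * norm y\<close>,
    so this factor splits off the expanded square.\<close>
  have "0 \<le> (norm (norm y *\<^sub>R x - norm x *\<^sub>R y))\<^sup>2" by simp
  also have "\<dots> = 2 * (norm x * norm y) * (norm x * norm y - Re (cinner x y))"
    by (simp only: norm_diff_sq cinner_scaleR_left cinner_scaleR_right norm_scaleR)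
      (simp add: power2_eq_square algebra_simps)
  finally show ?thesis
    using False by (auto simp: zero_le_mult_iff mult_le_0_iff)
qed auto

lemma cinner_Cauchy_Schwarz: "cmod (cinner x y) \<le> norm (x::'a::complex_inner) * norm y"
proof (cases "cinner x y = 0")
  case False
  \<comment> \<open>The unimodular \<open>c\<close> rotates the inner product onto its modulus,
    which reduces the claim to the bound on the real part.\<close>
  define c where "c = cnj (sgn (cinner x y))"
  have "cmod c = 1" using False by (simp add: c_def norm_sgn)
  have "cnj (cinner x y) * cinner x y = of_real ((cmod (cinner x y))\<^sup>2)"
    using complex_norm_square[of "cinner x y"] by (simp add: mult.commute)
  then have "cinner (c *\<^sub>C x) y = of_real (cmod (cinner x y))"
    using False by (simp add: c_def cinner_scaleC_left sgn_eq power2_eq_square)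
  then show ?thesis
    using Re_cinner_le[of "c *\<^sub>C x" y] \<open>cmod c = 1\<close> by (simp add: norm_scaleC)
qed simp

lemma bounded_bilinear_cinner: "bounded_bilinear (cinner :: 'a::complex_inner \<Rightarrow> 'a \<Rightarrow> complex)"
  by unfold_locales
    (auto simp: cinner_add_left cinner_add_right cinner_scaleR_left cinner_scaleR_right scaleR_conv_of_real
      intro!: exI[of _ 1] cinner_Cauchy_Schwarz)

lemmas tendsto_cinner = bounded_bilinear.tendsto[OF bounded_bilinear_cinner]

lemma cinner_eqI_left:
  fixes x y :: "'a::complex_inner"
  assumes "\<And>z. cinner x z = cinner y z"
  shows "x = y"
  using cinner_self[of "x - y"] assms[of "x - y"] by (simp add: cinner_diff_left)

lemma cinner_eqI_right:
  fixes x y :: "'a::complex_inner"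
  assumes "\<And>z. cinner z x = cinner z y"
  shows "x = y"
  using cinner_self[of "x - y"] assms[of "x - y"] by (simp add: cinner_diff_right)

text \<open>The representing vector minimizes \<open>\<parallel>x\<parallel>\<^sup>2 - 2 Re (f x)\<close>.\<close>

lemma riesz_representation:
  fixes f :: "'a::complex_hilbert \<Rightarrow> complex"
  assumes "bounded_linear f" and scaleC: "\<And>c x. f (c *\<^sub>C x) = c * f x"
  obtains z where "\<And>x. f x = cinner x z"
proof -
  interpret bounded_linear f by fact
  obtain K where K: "\<And>x. cmod (f x) \<le> norm x * K" using bounded by blast
  define q where "q x = (norm x)\<^sup>2 - 2 * Re (f x)" for x
  \<comment> \<open>Completing the square: \<open>q x\<close> is at least
    \<open>(norm x - K)^2 - K^2\<close>.\<close>
  have "- K\<^sup>2 \<le> q x" for x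
  proof -
    have "Re (f x) \<le> norm x * K" using K[of x] complex_Re_le_cmod[of "f x"] by linarith
    moreover have "0 \<le> (norm x - K)\<^sup>2" by simp
    ultimately show ?thesis by (simp add: q_def power2_diff)
  qed
  then have bdd: "bdd_below (range q)" by (intro bdd_belowI[of _ "- K\<^sup>2"]) auto
  define m where "m = (INF x. q x)"
  have m_le: "m \<le> q x" for x unfolding m_def by (rule cINF_lower[OF bdd]) simp
  have "\<exists>x. q x < m + inverse (real (Suc n))" for n
    using cINF_less_iff[OF _ bdd, of "m + inverse (real (Suc n))"] by (simp add: m_def)
  then obtain u where u: "\<And>n. q (u n) < m + inverse (real (Suc n))" by metis
  \<comment> \<open>Near-minimizers are near each other: the parallelogram law expresses the squared
    distance through \<open>q x\<close>, \<open>q y\<close> and \<open>q\<close> at the midpoint,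
    and the last value is at least \<open>m\<close>. Hence a minimizing sequence is Cauchy.\<close>
  have close: "(norm (x - y))\<^sup>2 \<le> 2 * (q x - m) + 2 * (q y - m)" for x y
  proof -
    have "(norm (x + y))\<^sup>2 + (norm (x - y))\<^sup>2 = 2 * (norm x)\<^sup>2 + 2 * (norm y)\<^sup>2"
      by (simp add: norm_add_sq norm_diff_sq)
    moreover have "q ((1/2) *\<^sub>R (x + y)) = (norm (x + y))\<^sup>2 / 4 - Re (f x) - Re (f y)"
      by (simp only: q_def scaleR norm_scaleR add) (simp add: power2_eq_square field_simps)
    ultimately show ?thesis
      using m_le[of "(1/2) *\<^sub>R (x + y)"] unfolding q_def by argo
  qed
  have "Cauchy u"
  proof (rule metric_CauchyI)
    fix e :: real assume "0 < e"
    then obtain M where M: "inverse (real (Suc M)) < e\<^sup>2 / 4"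
      using reals_Archimedean[of "e\<^sup>2 / 4"] by auto
    have q: "q (u n) - m < e\<^sup>2 / 4" if "n \<ge> M" for n
    proof -
      have "inverse (real (Suc n)) \<le> inverse (real (Suc M))" using that by simp
      then show ?thesis using u[of n] M by linarith
    qed
    show "\<exists>M. \<forall>i\<ge>M. \<forall>j\<ge>M. dist (u i) (u j) < e"
    proof (intro exI allI impI)
      fix i j assume "i \<ge> M" "j \<ge> M"
      then have "(norm (u i - u j))\<^sup>2 < e\<^sup>2"
        using close[of "u i" "u j"] q[of i] q[of j] by auto
      then show "dist (u i) (u j) < e"
        using \<open>0 < e\<close> by (simp add: dist_norm power_less_imp_less_base)
    qed
  qed
  then obtain z where z: "u \<longlonglongrightarrow> z" using Cauchy_convergent_iff convergent_def by blast
  have "(\<lambda>n. q (u n)) \<longlonglongrightarrow> q z"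
    unfolding q_def by (intro tendsto_intros z tendsto[OF z])
  moreover have "(\<lambda>n. m + inverse (real (Suc n))) \<longlonglongrightarrow> m + 0"
    by (intro tendsto_intros LIMSEQ_inverse_real_of_nat)
  ultimately have "q z \<le> m + 0"
    by (rule LIMSEQ_le) (intro exI allI impI less_imp_le u)
  then have min: "q z \<le> q x" for x using m_le[of x] by linarith
  \<comment> \<open>The first variation of \<open>q\<close> at the minimizer vanishes: the increment
    along \<open>t *\<^sub>R x\<close> is a quadratic in \<open>t\<close> with linear coefficient
    \<open>2 * d\<close> that never becomes negative.\<close>
  have Re: "Re (f x) = Re (cinner x z)" for x
  proof -
    define d where "d = Re (cinner x z) - Re (f x)"
    have pos: "0 \<le> t * (t * (norm x)\<^sup>2 + 2 * d)" for t
    proof -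
      have "q (z + t *\<^sub>R x) = q z + t * (t * (norm x)\<^sup>2 + 2 * d)"
        unfolding q_def norm_add_sq
        by (simp add: add scaleR cinner_scaleR_right d_def Re_cinner_commute[of z x]
            power2_eq_square algebra_simps)
      then show ?thesis using min[of "z + t *\<^sub>R x"] by linarith
    qed
    have "d = 0"
    proof (rule ccontr)
      assume "d \<noteq> 0"
      \<comment> \<open>At \<open>t = - d * s\<close> the linear term outweighs the quadratic one,
        since \<open>s\<close> times the squared norm of \<open>x\<close> is below 1; the
        \<open>+ 1\<close> also covers \<open>x = 0\<close>.\<close>
      define s where "s = 1 / ((norm x)\<^sup>2 + 1)"
      have s: "s * ((norm x)\<^sup>2 + 1) = 1" "s > 0"
        by (simp_all add: s_def add_nonneg_pos add_nonneg_eq_0_iff)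
      have "(- d * s) * ((- d * s) * (norm x)\<^sup>2 + 2 * d) = - (d\<^sup>2 * s * (2 - s * (norm x)\<^sup>2))"
        by (simp add: power2_eq_square algebra_simps)
      moreover have "2 - s * (norm x)\<^sup>2 > 0" using s by (simp add: algebra_simps)
      ultimately show False
        using pos[of "- d * s"] \<open>d \<noteq> 0\<close> \<open>s > 0\<close> by (smt (verit) mult_pos_pos zero_less_power2)
    qed
    then show ?thesis by (simp add: d_def)
  qed
  \<comment> \<open>The imaginary part of a complex-linear functional at \<open>x\<close> is minus
    its real part at \<open>\<i> *\<^sub>C x\<close>.\<close>
  have "f x = cinner x z" for x
    using Re[of x] Re[of "\<i> *\<^sub>C x"] by (simp add: complex_eq_iff scaleC cinner_scaleC_left)
  then show ?thesis by (rule that)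
qed

section \<open>Bounded operators and adjoints\<close>

lemma bounded_operators_scaleC:
  "T \<in> bounded_operators \<Longrightarrow> blinfun_apply T (c *\<^sub>C x) = c *\<^sub>C blinfun_apply T x"
  by (simp add: bounded_operators_def)

lemma zero_in_bounded_operators [intro]: "0 \<in> bounded_operators"
  by (simp add: bounded_operators_def)

lemma id_in_bounded_operators [intro]: "id_blinfun \<in> bounded_operators"
  by (simp add: bounded_operators_def)

lemma comp_in_bounded_operators [intro]:
  "S \<in> bounded_operators \<Longrightarrow> T \<in> bounded_operators \<Longrightarrow> S o\<^sub>L T \<in> bounded_operators"
  by (simp add: bounded_operators_def)

lemma add_in_bounded_operators [intro]:
  "S \<in> bounded_operators \<Longrightarrow> T \<in> bounded_operators \<Longrightarrow> S + T \<in> bounded_operators"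
  by (simp add: bounded_operators_def blinfun.add_left scaleC_add_right)

lemma scaleR_in_bounded_operators [intro]:
  "T \<in> bounded_operators \<Longrightarrow> r *\<^sub>R T \<in> bounded_operators"
  by (simp add: bounded_operators_def blinfun.scaleR_left scaleC_scaleR)

lemma sum_in_bounded_operators [intro]:
  "(\<And>i. i \<in> I \<Longrightarrow> T i \<in> bounded_operators) \<Longrightarrow> (\<Sum>i\<in>I. T i) \<in> bounded_operators"
  by (induction I rule: infinite_finite_induct) auto

lemma adjoint_unique:
  assumes "\<And>x y. cinner (blinfun_apply T x) y = cinner x (blinfun_apply T1 y)"
    and "\<And>x y. cinner (blinfun_apply T x) y = cinner x (blinfun_apply T2 y)"
  shows "T1 = T2"
  by (metis assms blinfun_eqI cinner_eqI_right)

lemma adj_eqI: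
  assumes "T' \<in> bounded_operators"
    and "\<And>x y. cinner (blinfun_apply T x) y = cinner x (blinfun_apply T' y)"
  shows "adj T = T'"
  unfolding adj_def using assms adjoint_unique[of T] by (intro the_equality) auto

text \<open>For each \<open>y\<close>, Riesz representation turns
  \<open>x \<mapsto> cinner (T x) y\<close> into a vector \<open>A y\<close>. Uniqueness of that
  vector makes \<open>A\<close> complex-linear, and Cauchy-Schwarz applied to
  \<open>cinner (T (A y)) y\<close> bounds it. This gives the definite description in
  \<open>adj\<close> its meaning.\<close>

lemma adj:
  assumes T: "T \<in> bounded_operators"
  shows adj_in_bounded_operators: "adj T \<in> bounded_operators"
    and cinner_adj_right: "cinner x (blinfun_apply (adj T) y) = cinner (blinfun_apply T x) y"
proof -
  have "\<exists>z. \<forall>x. cinner (blinfun_apply T x) y = cinner x z" for y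
  proof -
    have bl: "bounded_linear (\<lambda>x. cinner (blinfun_apply T x) y)"
      by (rule bounded_linear_compose[OF bounded_bilinear.bounded_linear_left[OF bounded_bilinear_cinner]
            blinfun.bounded_linear_right])
    have sc: "cinner (blinfun_apply T (c *\<^sub>C x)) y = c * cinner (blinfun_apply T x) y" for c x
      by (simp add: bounded_operators_scaleC[OF T] cinner_scaleC_left)
    show ?thesis by (rule riesz_representation[OF bl sc]) blast
  qed
  then obtain A where A: "\<And>x y. cinner (blinfun_apply T x) y = cinner x (A y)" by metis
  have "bounded_linear A"
  proof
    show "A (x + y) = A x + A y" "A (r *\<^sub>R x) = r *\<^sub>R A x" for x y r
      by (rule cinner_eqI_right; simp add: cinner_add_right cinner_scaleR_right flip: A)+
    have "norm (A y) \<le> norm y * norm T" for y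
    proof (cases "A y = 0")
      case False
      have "(norm (A y))\<^sup>2 = cmod (cinner (blinfun_apply T (A y)) y)"
        by (simp add: A cinner_self norm_power)
      also have "\<dots> \<le> norm T * norm (A y) * norm y"
        by (meson cinner_Cauchy_Schwarz mult_right_mono norm_blinfun norm_ge_zero order_trans)
      finally show ?thesis using False by (simp add: power2_eq_square mult_ac)
    qed simp
    then show "\<exists>K. \<forall>x. norm (A x) \<le> norm x * K" by blast
  qed
  then have A_apply: "blinfun_apply (Blinfun A) = A" by (rule bounded_linear_Blinfun_apply)
  have "A (c *\<^sub>C y) = c *\<^sub>C A y" for c y
    by (rule cinner_eqI_right) (simp add: cinner_scaleC_right flip: A)
  then have "Blinfun A \<in> bounded_operators"
    by (simp add: bounded_operators_def A_apply)
  moreover from this have "adj T = Blinfun A" by (rule adj_eqI) (simp add: A_apply A)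
  ultimately show "adj T \<in> bounded_operators"
    "cinner x (blinfun_apply (adj T) y) = cinner (blinfun_apply T x) y"
    by (simp_all add: A_apply A)
qed

lemma cinner_adj_left:
  assumes "T \<in> bounded_operators"
  shows "cinner (blinfun_apply (adj T) x) y = cinner x (blinfun_apply T y)"
  by (metis assms cinner_adj_right cinner_commute)

section \<open>Projections and operators with real quadratic form\<close>

lemma projections_iff:
  "P \<in> projections \<longleftrightarrow> P \<in> bounded_operators \<and> P o\<^sub>L P = P \<and>
    (\<forall>x y. cinner (blinfun_apply P x) y = cinner x (blinfun_apply P y))"
  unfolding projections_def using adj_eqI[of P P] cinner_adj_right[of P] by auto

lemma cinner_projection_self:
  assumes "P \<in> projections"
  shows "cinner (blinfun_apply P g) g = of_real ((norm (blinfun_apply P g))\<^sup>2)"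
proof -
  have "blinfun_apply P (blinfun_apply P g) = blinfun_apply P g"
    using assms by (metis projections_iff blinfun_apply_blinfun_compose)
  then show ?thesis
    using assms by (metis cinner_self projections_iff)
qed

text \<open>Replacing \<open>g\<close> by \<open>\<i> g\<close> in \<open>Im (\<langle>Tg, h\<rangle> + \<langle>Th, g\<rangle>) = 0\<close> gives
  \<open>Re (\<langle>Tg, h\<rangle> - \<langle>Th, g\<rangle>) = 0\<close>.\<close>

lemma real_quadratic_form_imp_symmetric:
  assumes T: "T \<in> bounded_operators"
    and Q: "\<And>g. cinner (blinfun_apply T g) g = of_real (Q g)"
  shows "cinner (blinfun_apply T h) g = cnj (cinner (blinfun_apply T g) h)"
proof -
  have 1: "Im (cinner (blinfun_apply T g) h) + Im (cinner (blinfun_apply T h) g) = 0" for g h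
    using arg_cong[OF Q[of "g + h"], of Im] arg_cong[OF Q[of g], of Im] arg_cong[OF Q[of h], of Im]
    by (simp add: blinfun.add_right cinner_add_left cinner_add_right)
  have "Re (cinner (blinfun_apply T g) h) - Re (cinner (blinfun_apply T h) g) = 0"
    using 1[of "\<i> *\<^sub>C g" h]
    by (simp add: bounded_operators_scaleC[OF T] cinner_scaleC_left cinner_scaleC_right)
  with 1[of g h] show ?thesis by (simp add: complex_eq_iff)
qed

text \<open>Symmetry of the form leaves only two terms in each part, and halving the arguments
  absorbs the factor 1/4. Each part is thus a plain difference of two values of \<open>Q\<close>;
  when \<open>Q\<close> is the mass of a set or an integral, it becomes a difference of two positive
  measures or of their integrals.\<close>

lemma polarization:
  assumes T: "T \<in> bounded_operators"
    and Q: "\<And>g. cinner (blinfun_apply T g) g = of_real (Q g)"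
  shows Re_polarization: "Re (cinner (blinfun_apply T g) h) = Q ((1/2) *\<^sub>R (g + h)) - Q ((1/2) *\<^sub>R (g - h))"
    and Im_polarization: "Im (cinner (blinfun_apply T g) h) =
      Q ((1/2) *\<^sub>R (g + \<i> *\<^sub>C h)) - Q ((1/2) *\<^sub>R (g - \<i> *\<^sub>C h))"
proof -
  have Q_half: "4 * Q ((1/2) *\<^sub>R g) = Q g" for g
    using arg_cong[OF Q[of "(1/2) *\<^sub>R g"], of Re] arg_cong[OF Q[of g], of Re]
    by (simp add: blinfun.scaleR_right cinner_scaleR_left cinner_scaleR_right)
  have *: "Re (cinner (blinfun_apply T g) h) = Q ((1/2) *\<^sub>R (g + h)) - Q ((1/2) *\<^sub>R (g - h))" for g h
    using arg_cong[OF Q[of "g + h"], of Re] arg_cong[OF Q[of "g - h"], of Re] Q_half[of "g + h"]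
      Q_half[of "g - h"] real_quadratic_form_imp_symmetric[OF T Q, of h g]
    by (simp add: blinfun.add_right blinfun.diff_right cinner_add_left cinner_add_right
        cinner_diff_left cinner_diff_right)
  show "Re (cinner (blinfun_apply T g) h) = Q ((1/2) *\<^sub>R (g + h)) - Q ((1/2) *\<^sub>R (g - h))"
    by (rule *)
  \<comment> \<open>Conjugate linearity in the second argument turns the real part at
    \<open>\<i> *\<^sub>C h\<close> into the imaginary part at \<open>h\<close>.\<close>
  show "Im (cinner (blinfun_apply T g) h) =
      Q ((1/2) *\<^sub>R (g + \<i> *\<^sub>C h)) - Q ((1/2) *\<^sub>R (g - \<i> *\<^sub>C h))"
    using *[of g "\<i> *\<^sub>C h"] by (simp add: cinner_scaleC_right)
qed

text \<open>For symmetric operators the numerical radius controls the norm without loss of a factor: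
  polarize the pairing of \<open>T g\<close> with a vector parallel to it, then apply the
  parallelogram law.\<close>

lemma norm_le_of_quadratic_form:
  assumes T: "T \<in> bounded_operators"
    and Q: "\<And>g. cinner (blinfun_apply T g) g = of_real (Q g)"
    and le: "\<And>g. \<bar>Q g\<bar> \<le> c * (norm g)\<^sup>2" and "0 \<le> c"
  shows "norm T \<le> c"
proof (rule norm_blinfun_bound[OF \<open>0 \<le> c\<close>])
  fix g
  show "norm (blinfun_apply T g) \<le> c * norm g"
  proof (cases "g = 0 \<or> blinfun_apply T g = 0")
    case False
    \<comment> \<open>The scale gives \<open>h\<close> the length of \<open>g\<close>, so that the
      parallelogram law yields exactly four times the squared norm of \<open>g\<close>.\<close>
    define s where "s = norm g / norm (blinfun_apply T g)"
    define h where "h = s *\<^sub>R blinfun_apply T g"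
    have h: "norm h = norm g" using False by (simp add: h_def s_def)
    have "norm g * norm (blinfun_apply T g) = Re (cinner (blinfun_apply T g) h)"
      using False by (simp add: h_def s_def cinner_scaleR_right cinner_self power2_eq_square)
    also have "\<dots> = Q ((1/2) *\<^sub>R (g + h)) - Q ((1/2) *\<^sub>R (g - h))"
      by (rule Re_polarization[OF T Q])
    also have "\<dots> \<le> c * (norm ((1/2) *\<^sub>R (g + h)))\<^sup>2 + c * (norm ((1/2) *\<^sub>R (g - h)))\<^sup>2"
      using le[of "(1/2) *\<^sub>R (g + h)"] le[of "(1/2) *\<^sub>R (g - h)"] by linarith
    also have "\<dots> = c / 4 * ((norm (g + h))\<^sup>2 + (norm (g - h))\<^sup>2)"
      by (simp only: norm_scaleR) (simp add: power2_eq_square algebra_simps)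
    also have "(norm (g + h))\<^sup>2 + (norm (g - h))\<^sup>2 = 4 * (norm g)\<^sup>2"
      by (simp add: norm_add_sq norm_diff_sq h)
    also have "c / 4 * (4 * (norm g)\<^sup>2) = norm g * (c * norm g)"
      by (simp add: power2_eq_square)
    finally show ?thesis using False by simp
  qed (auto simp: \<open>0 \<le> c\<close>)
qed

section \<open>Signed measures\<close>

lemma abs_bounded_iff: "bounded (range f) \<longleftrightarrow> (\<exists>C. \<forall>x. \<bar>f x :: real\<bar> \<le> C)"
  by (auto simp: bounded_iff)

text \<open>The approximating simple functions are \<open>\<lfloor>(n + 1) f\<rfloor> / (n + 1)\<close>.\<close>

lemma bounded_measurable_induct [consumes 2, case_names indicator lin lim]:
  fixes f :: "'a::topological_space \<Rightarrow> real"
  assumes f: "f \<in> borel_measurable borel" "bounded (range f)"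
    and indicator: "\<And>A. A \<in> sets borel \<Longrightarrow> P (indicat_real A)"
    and lin: "\<And>a u v. u \<in> borel_measurable borel \<Longrightarrow> bounded (range u) \<Longrightarrow> P u \<Longrightarrow>
      v \<in> borel_measurable borel \<Longrightarrow> bounded (range v) \<Longrightarrow> P v \<Longrightarrow> P (\<lambda>x. a * u x + v x)"
    and lim: "\<And>u v. (\<And>n. u n \<in> borel_measurable borel) \<Longrightarrow> (\<And>n. bounded (range (u n))) \<Longrightarrow>
      (\<And>n. P (u n)) \<Longrightarrow> v \<in> borel_measurable borel \<Longrightarrow> bounded (range v) \<Longrightarrow>
      uniform_limit UNIV u v sequentially \<Longrightarrow> P v"
  shows "P f"
proof -
  note [measurable] = f(1)
  obtain C where C: "\<And>x. \<bar>f x\<bar> \<le> C" using f(2) unfolding abs_bounded_iff by blast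
  \<comment> \<open>Measurability and boundedness travel with \<open>P\<close> through the induction
    because the hypothesis \<open>lin\<close> asks for them.\<close>
  have simple: "(\<lambda>x. \<Sum>k\<in>K. c k * indicat_real (A k) x) \<in> borel_measurable borel \<and>
      bounded (range (\<lambda>x. \<Sum>k\<in>K. c k * indicat_real (A k) x)) \<and>
      P (\<lambda>x. \<Sum>k\<in>K. c k * indicat_real (A k) x)"
    if "finite K" "\<And>k. A k \<in> sets borel" for K :: "int set" and c A
    using that(1)
  proof (induction K)
    case empty
    have "P (indicat_real {})" by (rule indicator) simp
    moreover have "indicat_real {} = (\<lambda>x::'a. 0)" by auto
    ultimately show ?case by (auto simp: abs_bounded_iff)
  next
    case (insert k K)
    have "indicat_real (A k) \<in> borel_measurable borel" using that(2) by simp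
    moreover have "bounded (range (indicat_real (A k)))"
      by (auto simp: abs_bounded_iff indicator_def intro!: exI[of _ 1])
    moreover have "P (indicat_real (A k))" by (intro indicator that(2))
    ultimately have *: "P (\<lambda>x. c k * indicat_real (A k) x + (\<Sum>k\<in>K. c k * indicat_real (A k) x))"
      using insert.IH by (intro lin) auto
    have "\<bar>\<Sum>k\<in>insert k K. c k * indicat_real (A k) x\<bar> \<le> (\<Sum>k\<in>insert k K. \<bar>c k\<bar>)" for x
      by (rule order_trans[OF sum_abs]) (auto intro!: sum_mono simp: indicator_def)
    then have "bounded (range (\<lambda>x. \<Sum>k\<in>insert k K. c k * indicat_real (A k) x))"
      unfolding abs_bounded_iff by blast
    moreover have "(\<lambda>x. \<Sum>k\<in>insert k K. c k * indicat_real (A k) x) \<in> borel_measurable borel"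
      using that(2) by (intro borel_measurable_sum borel_measurable_times borel_measurable_indicator) auto
    ultimately show ?case
      using * by (simp only: sum.insert[OF insert.hyps] simp_thms)
  qed
  define u where "u n x = real_of_int \<lfloor>real (Suc n) * f x\<rfloor> / real (Suc n)" for n x
  have u: "u n \<in> borel_measurable borel \<and> bounded (range (u n)) \<and> P (u n)" for n
  proof -
    \<comment> \<open>Boundedness of \<open>f\<close> leaves finitely many floor values, so
      \<open>u n\<close> is a finite combination of indicators of level sets.\<close>
    define K where "K = {\<lfloor>real (Suc n) * - C\<rfloor>..\<lfloor>real (Suc n) * C\<rfloor>}"
    have K: "\<lfloor>real (Suc n) * f x\<rfloor> \<in> K" for x
      using C[of x] unfolding K_def atLeastAtMost_iff
      by (intro conjI floor_mono mult_left_mono) (auto simp: abs_le_iff)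
    define A where "A k = {x. \<lfloor>real (Suc n) * f x\<rfloor> = k}" for k
    have "u n = (\<lambda>x. \<Sum>k\<in>K. (real_of_int k / real (Suc n)) * indicat_real (A k) x)"
    proof
      fix x
      have "(\<Sum>k\<in>K. (real_of_int k / real (Suc n)) * indicat_real (A k) x) =
          (\<Sum>k\<in>K. if k = \<lfloor>real (Suc n) * f x\<rfloor> then real_of_int k / real (Suc n) else 0)"
        by (intro sum.cong) (auto simp: A_def)
      also have "\<dots> = u n x"
        using K[of x] by (simp add: u_def K_def)
      finally show "u n x = (\<Sum>k\<in>K. (real_of_int k / real (Suc n)) * indicat_real (A k) x)" ..
    qed
    moreover have "A k \<in> sets borel" for k unfolding A_def by measurable
    moreover have "finite K" by (simp add: K_def)
    ultimately show ?thesis by (simp only: simple)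
  qed
  have "uniform_limit UNIV u f sequentially"
  proof (rule uniform_limitI)
    fix e :: real assume "0 < e"
    then obtain N where N: "inverse (real (Suc N)) < e" using reals_Archimedean by auto
    have "dist (u n x) (f x) < e" if "N \<le> n" for n x
    proof -
      have "\<bar>real_of_int \<lfloor>real (Suc n) * f x\<rfloor> - real (Suc n) * f x\<bar> \<le> 1" by linarith
      then have "\<bar>real_of_int \<lfloor>real (Suc n) * f x\<rfloor> - real (Suc n) * f x\<bar> / real (Suc n) \<le> 1 / real (Suc n)"
        by (rule divide_right_mono) simp
      moreover have "u n x - f x = (real_of_int \<lfloor>real (Suc n) * f x\<rfloor> - real (Suc n) * f x) / real (Suc n)"
        by (simp add: u_def diff_divide_distrib del: of_nat_Suc)
      ultimately have "dist (u n x) (f x) \<le> inverse (real (Suc n))"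
        by (simp add: dist_real_def inverse_eq_divide del: of_nat_Suc)
      also have "\<dots> \<le> inverse (real (Suc N))" using that by simp
      finally show ?thesis using N by linarith
    qed
    then show "\<forall>\<^sub>F n in sequentially. \<forall>x\<in>UNIV. dist (u n x) (f x) < e"
      unfolding eventually_sequentially by blast
  qed
  with u f show ?thesis by (intro lim[of u f]) auto
qed

section \<open>Integrals of bounded Borel functions against finite measures\<close>

lemma integrable_bounded_measurable:
  fixes f :: "'a::topological_space \<Rightarrow> real"
  assumes "finite_measure M" "sets M = sets borel"
    and "f \<in> borel_measurable borel" "bounded (range f)"
  shows "integrable M f"
proof -
  obtain C where C: "\<And>x. \<bar>f x\<bar> \<le> C" using assms(4) unfolding abs_bounded_iff by blast
  have f: "f \<in> borel_measurable M" using assms(3) by (simp only: measurable_cong_sets[OF assms(2) refl])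
  show ?thesis
    by (rule finite_measure.integrable_const_bound[OF assms(1) _ f, of C]) (simp add: C)
qed

lemma abs_integral_le:
  fixes f :: "'a::topological_space \<Rightarrow> real"
  assumes "finite_measure M" "sets M = sets borel"
    and "f \<in> borel_measurable borel" and C: "\<And>x. \<bar>f x\<bar> \<le> C"
  shows "\<bar>\<integral>x. f x \<partial>M\<bar> \<le> C * measure M UNIV"
proof -
  have space: "space M = UNIV" using sets_eq_imp_space_eq[OF assms(2)] by simp
  have "integrable M f"
    using assms by (intro integrable_bounded_measurable) (auto simp: abs_bounded_iff)
  moreover have "integrable M (\<lambda>x. C)"
    using assms(1) by (simp add: finite_measure.integrable_const)
  ultimately have "(\<integral>x. \<bar>f x\<bar> \<partial>M) \<le> (\<integral>x. C \<partial>M)"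
    using C by (intro integral_mono) auto
  moreover have "\<bar>\<integral>x. f x \<partial>M\<bar> \<le> (\<integral>x. \<bar>f x\<bar> \<partial>M)"
    using integral_norm_bound[of M f] by simp
  moreover have "(\<integral>x. C \<partial>M) = C * measure M UNIV"
    by (simp add: space)
  ultimately show ?thesis by linarith
qed

lemma tendsto_integral_uniform_limit:
  fixes u :: "nat \<Rightarrow> 'a::topological_space \<Rightarrow> real"
  assumes M: "finite_measure M" "sets M = sets borel"
    and u: "\<And>n. u n \<in> borel_measurable borel" "\<And>n. bounded (range (u n))"
    and f: "f \<in> borel_measurable borel" "bounded (range f)"
    and lim: "uniform_limit UNIV u f sequentially"
  shows "(\<lambda>n. \<integral>x. u n x \<partial>M) \<longlonglongrightarrow> (\<integral>x. f x \<partial>M)"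
proof (rule LIMSEQ_I)
  fix e :: real assume "0 < e"
  \<comment> \<open>The \<open>+ 1\<close> keeps the denominator positive for a null measure and
    makes the final estimate strict.\<close>
  define d where "d = e / (measure M UNIV + 1)"
  have "0 < d" using \<open>0 < e\<close> by (simp add: d_def add_nonneg_pos)
  then obtain N where N: "\<And>n x. n \<ge> N \<Longrightarrow> \<bar>u n x - f x\<bar> < d"
    using lim unfolding uniform_limit_sequentially_iff dist_real_def by blast
  have "norm ((\<integral>x. u n x \<partial>M) - (\<integral>x. f x \<partial>M)) < e" if "n \<ge> N" for n
  proof -
    have "(\<integral>x. u n x \<partial>M) - (\<integral>x. f x \<partial>M) = (\<integral>x. u n x - f x \<partial>M)"
      by (intro Bochner_Integration.integral_diff[symmetric] integrable_bounded_measurable M u f)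
    moreover have "\<bar>\<integral>x. u n x - f x \<partial>M\<bar> \<le> d * measure M UNIV"
      using N[OF that] by (intro abs_integral_le M borel_measurable_diff u f less_imp_le)
    moreover have "d * measure M UNIV < d * (measure M UNIV + 1)"
      using \<open>0 < d\<close> by simp
    moreover have "d * (measure M UNIV + 1) = e"
      unfolding d_def using add_nonneg_pos[OF measure_nonneg zero_less_one, of M UNIV] by simp
    ultimately show ?thesis by simp
  qed
  then show "\<exists>N. \<forall>n\<ge>N. norm ((\<integral>x. u n x \<partial>M) - (\<integral>x. f x \<partial>M)) < e" by blast
qed

text \<open>The left-hand side is linear in \<open>f\<close> and continuous under uniform limits, so
  a relation checked on indicators extends to bounded Borel functions. The real coefficients allow
  subtraction, so equalities between sums or differences of measures can be integrated without
  signed measures.\<close>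

lemma sum_integral_eq_0:
  fixes f :: "'a::topological_space \<Rightarrow> real" and M :: "'i \<Rightarrow> 'a measure"
  assumes M: "\<And>i. i \<in> I \<Longrightarrow> finite_measure (M i)" "\<And>i. i \<in> I \<Longrightarrow> sets (M i) = sets borel"
    and eq: "\<And>A. A \<in> sets borel \<Longrightarrow> (\<Sum>i\<in>I. c i * measure (M i) A) = 0"
    and f: "f \<in> borel_measurable borel" "bounded (range f)"
  shows "(\<Sum>i\<in>I. c i * (\<integral>x. f x \<partial>M i)) = 0"
  using f
proof (induction rule: bounded_measurable_induct)
  case (indicator A)
  have "(\<integral>x. indicat_real A x \<partial>M i) = measure (M i) A" if "i \<in> I" for i
    using M(2)[OF that] indicator sets_eq_imp_space_eq[OF M(2)[OF that]] by simp
  then show ?case using eq[OF indicator] by (simp cong: sum.cong)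
next
  case (lin a u v)
  have "(\<integral>x. a * u x + v x \<partial>M i) = a * (\<integral>x. u x \<partial>M i) + (\<integral>x. v x \<partial>M i)" if "i \<in> I" for i
    using integrable_bounded_measurable[OF M[OF that] lin(1,2)]
      integrable_bounded_measurable[OF M[OF that] lin(3,4)] by simp
  then have "(\<Sum>i\<in>I. c i * (\<integral>x. a * u x + v x \<partial>M i)) =
      a * (\<Sum>i\<in>I. c i * (\<integral>x. u x \<partial>M i)) + (\<Sum>i\<in>I. c i * (\<integral>x. v x \<partial>M i))"
    by (simp add: sum.distrib sum_distrib_left algebra_simps cong: sum.cong)
  then show ?case using lin.IH by simp
next
  case (lim u v)
  have "(\<lambda>n. \<Sum>i\<in>I. c i * (\<integral>x. u n x \<partial>M i)) \<longlonglongrightarrow> (\<Sum>i\<in>I. c i * (\<integral>x. v x \<partial>M i))"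
    by (intro tendsto_sum tendsto_mult_left tendsto_integral_uniform_limit M lim)
  then show ?case using lim.IH by (simp add: LIMSEQ_const_iff)
qed

section \<open>Hahn and Jordan decompositions of a difference of finite measures\<close>

lemma signed_measure_Hahn:
  fixes \<nu> :: "'a::topological_space set \<Rightarrow> real"
  assumes M: "finite_measure M1" "sets M1 = sets borel" "finite_measure M2" "sets M2 = sets borel"
    and \<nu>: "\<And>A. A \<in> sets borel \<Longrightarrow> \<nu> A = measure M1 A - measure M2 A"
  obtains Y where "Y \<in> sets borel"
    "\<And>A. A \<in> sets borel \<Longrightarrow> A \<subseteq> Y \<Longrightarrow> 0 \<le> \<nu> A" "\<And>A. A \<in> sets borel \<Longrightarrow> A \<inter> Y = {} \<Longrightarrow> \<nu> A \<le> 0"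
proof -
  interpret M1: finite_measure M1 by fact
  interpret M2: finite_measure M2 by fact
  show ?thesis
    using finite_unsigned_Hahn_decomposition[OF M(1,3)] M(2,4) \<nu>
    by (auto simp: M1.emeasure_eq_measure M2.emeasure_eq_measure intro!: that)
qed

text \<open>The supremum over subsets of \<open>A\<close> is attained at
  \<open>A \<inter> Y\<close>: discarding \<open>B - Y\<close> and adding
  \<open>(A - B) \<inter> Y\<close> can only increase \<open>\<nu> B\<close>. The Hahn set is a
  parameter, so that \<open>- \<nu>\<close> with the complement of \<open>Y\<close> yields the
  negative variation.\<close>

lemma positive_variation_eq:
  fixes \<nu> :: "'a::topological_space set \<Rightarrow> real"
  assumes M: "finite_measure M1" "sets M1 = sets borel" "finite_measure M2" "sets M2 = sets borel"
    and \<nu>: "\<And>A. A \<in> sets borel \<Longrightarrow> \<nu> A = measure M1 A - measure M2 A"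
    and Y: "Y \<in> sets borel" "\<And>A. A \<in> sets borel \<Longrightarrow> A \<subseteq> Y \<Longrightarrow> 0 \<le> \<nu> A"
      "\<And>A. A \<in> sets borel \<Longrightarrow> A \<inter> Y = {} \<Longrightarrow> \<nu> A \<le> 0"
  shows "finite_measure (positive_variation borel \<nu>)"
    and "sets (positive_variation borel \<nu>) = sets borel"
    and "A \<in> sets borel \<Longrightarrow> measure (positive_variation borel \<nu>) A = \<nu> (A \<inter> Y)"
proof -
  interpret M1: finite_measure M1 by fact
  interpret M2: finite_measure M2 by fact
  have Un: "\<nu> (A \<union> B) = \<nu> A + \<nu> B" if "A \<in> sets borel" "B \<in> sets borel" "A \<inter> B = {}" for A B
    using that M(2,4) by (simp add: \<nu> M1.finite_measure_Union M2.finite_measure_Union)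
  have sup: "(SUP B\<in>{B \<in> sets borel. B \<subseteq> A}. ennreal (\<nu> B)) = ennreal (\<nu> (A \<inter> Y))"
    if A: "A \<in> sets borel" for A
  proof (rule antisym)
    show "(SUP B\<in>{B \<in> sets borel. B \<subseteq> A}. ennreal (\<nu> B)) \<le> ennreal (\<nu> (A \<inter> Y))"
    proof (rule SUP_least)
      fix B assume "B \<in> {B \<in> sets borel. B \<subseteq> A}"
      then have B: "B \<in> sets borel" "B \<subseteq> A" by auto
      have "\<nu> B = \<nu> (B \<inter> Y) + \<nu> (B - Y)"
        using Un[of "B \<inter> Y" "B - Y"] B Y(1) by (auto simp: Int_Diff_Un)
      moreover have "A \<inter> Y = (B \<inter> Y) \<union> ((A - B) \<inter> Y)" using B by auto
      then have "\<nu> (A \<inter> Y) = \<nu> (B \<inter> Y) + \<nu> ((A - B) \<inter> Y)"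
        using Un[of "B \<inter> Y" "(A - B) \<inter> Y"] A B Y(1) by auto
      moreover have "\<nu> (B - Y) \<le> 0" using B Y by (intro Y(3)) auto
      moreover have "0 \<le> \<nu> ((A - B) \<inter> Y)" using A B Y by (intro Y(2)) auto
      ultimately show "ennreal (\<nu> B) \<le> ennreal (\<nu> (A \<inter> Y))"
        by (intro ennreal_leI) linarith
    qed
    show "ennreal (\<nu> (A \<inter> Y)) \<le> (SUP B\<in>{B \<in> sets borel. B \<subseteq> A}. ennreal (\<nu> B))"
      using A Y(1) by (intro SUP_upper) auto
  qed
  \<comment> \<open>Without countable additivity \<open>measure_of\<close> would return the zero
    measure.\<close>
  have ca: "countably_additive (sets borel) (\<lambda>A. SUP B\<in>{B \<in> sets borel. B \<subseteq> A}. ennreal (\<nu> B))"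
    unfolding countably_additive_def
  proof (intro allI impI)
    fix A :: "nat \<Rightarrow> 'a set"
    assume A: "range A \<subseteq> sets borel" "disjoint_family A" and U: "\<Union> (range A) \<in> sets borel"
    have AY: "range (\<lambda>n. A n \<inter> Y) \<subseteq> sets borel" "disjoint_family (\<lambda>n. A n \<inter> Y)"
      using A Y(1) by (auto simp: disjoint_family_on_def)
    have "(\<lambda>n. \<nu> (A n \<inter> Y)) sums \<nu> (\<Union>n. A n \<inter> Y)"
      using sums_diff[OF M1.finite_measure_UNION[OF _ AY(2)] M2.finite_measure_UNION[OF _ AY(2)]]
        AY(1) M(2,4) U Y(1) by (auto simp: subset_iff \<nu>)
    then have "(\<Sum>n. ennreal (\<nu> (A n \<inter> Y))) = ennreal (\<nu> (\<Union>n. A n \<inter> Y))"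
      using AY(1) by (intro suminf_ennreal_eq Y(2)) auto
    moreover have "(\<Union>n. A n \<inter> Y) = (\<Union>n. A n) \<inter> Y" by auto
    ultimately show "(\<Sum>n. SUP B\<in>{B \<in> sets borel. B \<subseteq> A n}. ennreal (\<nu> B)) =
        (SUP B\<in>{B \<in> sets borel. B \<subseteq> \<Union> (range A)}. ennreal (\<nu> B))"
      using A(1) U by (simp add: sup range_subsetD)
  qed
  have "positive (sets borel) (\<lambda>A. SUP B\<in>{B \<in> sets borel. B \<subseteq> A}. ennreal (\<nu> B))"
    using sup[of "{}"] by (simp add: positive_def \<nu>)
  then have em: "emeasure (positive_variation borel \<nu>) A = ennreal (\<nu> (A \<inter> Y))"
    if "A \<in> sets borel" for A
    unfolding positive_variation_def
    using emeasure_measure_of_sigma[OF sets.sigma_algebra_axioms[of borel] _ ca that] sup[OF that]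
    by simp
  have space: "space (positive_variation borel \<nu>) = UNIV"
    by (simp add: positive_variation_def space_measure_of_conv)
  show "sets (positive_variation borel \<nu>) = sets borel"
    unfolding positive_variation_def by (metis sets.sets_measure_of_eq)
  show "finite_measure (positive_variation borel \<nu>)"
    by (rule finite_measureI) (simp add: space em)
  show "A \<in> sets borel \<Longrightarrow> measure (positive_variation borel \<nu>) A = \<nu> (A \<inter> Y)"
    using Y(1) by (simp add: measure_def em Y(2))
qed

text \<open>Every decomposition into finite positive measures gives the same integral as the Jordan
  one: the differences agree on Borel sets, hence also when integrated.\<close>

lemma signed_measure_integral_diff:
  fixes \<phi> :: "'a::topological_space \<Rightarrow> real"
  assumes M: "finite_measure M1" "sets M1 = sets borel" "finite_measure M2" "sets M2 = sets borel"
    and \<nu>: "\<And>A. A \<in> sets borel \<Longrightarrow> \<nu> A = measure M1 A - measure M2 A"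
    and \<phi>: "\<phi> \<in> borel_measurable borel" "bounded (range \<phi>)"
  shows "signed_measure_integral borel \<nu> (\<lambda>x. of_real (\<phi> x)) = of_real ((\<integral>x. \<phi> x \<partial>M1) - (\<integral>x. \<phi> x \<partial>M2))"
proof -
  obtain Y where Y: "Y \<in> sets borel" "\<And>A. A \<in> sets borel \<Longrightarrow> A \<subseteq> Y \<Longrightarrow> 0 \<le> \<nu> A"
    "\<And>A. A \<in> sets borel \<Longrightarrow> A \<inter> Y = {} \<Longrightarrow> \<nu> A \<le> 0"
    using signed_measure_Hahn[OF M \<nu>] by blast
  define P where "P = positive_variation borel \<nu>"
  define N where "N = positive_variation borel (\<lambda>A. - \<nu> A)"
  have P: "finite_measure P" "sets P = sets borel"
      "\<And>A. A \<in> sets borel \<Longrightarrow> measure P A = \<nu> (A \<inter> Y)"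
    unfolding P_def by (rule positive_variation_eq[OF M \<nu> Y]; assumption)+
  \<comment> \<open>For \<open>- \<nu>\<close> the two measures change places and \<open>- Y\<close>
    is the Hahn set.\<close>
  have \<nu>': "- \<nu> A = measure M2 A - measure M1 A" if "A \<in> sets borel" for A
    using \<nu>[OF that] by simp
  have Y': "- Y \<in> sets borel" by (rule borel_comp[OF Y(1)])
  have Y'_ge: "0 \<le> - \<nu> A" if "A \<in> sets borel" "A \<subseteq> - Y" for A
    using Y(3)[OF that(1)] that(2) by (simp add: disjoint_eq_subset_Compl)
  have Y'_le: "- \<nu> A \<le> 0" if "A \<in> sets borel" "A \<inter> - Y = {}" for A
    using Y(2)[OF that(1)] that(2) by (simp add: disjoint_eq_subset_Compl)
  have N: "finite_measure N" "sets N = sets borel"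
      "\<And>A. A \<in> sets borel \<Longrightarrow> measure N A = - \<nu> (A \<inter> - Y)"
    unfolding N_def
    by (rule positive_variation_eq[where \<nu> = "\<lambda>A. - \<nu> A", OF M(3,4,1,2) \<nu>' Y' Y'_ge Y'_le]; assumption)+
  have \<nu>_split: "\<nu> A = \<nu> (A \<inter> Y) + \<nu> (A \<inter> - Y)" if A: "A \<in> sets borel" for A
  proof -
    interpret M1: finite_measure M1 by fact
    interpret M2: finite_measure M2 by fact
    have A_eq: "A = A \<inter> Y \<union> A \<inter> - Y" and disj: "(A \<inter> Y) \<inter> (A \<inter> - Y) = {}" by auto
    have sets: "A \<inter> Y \<in> sets borel" "A \<inter> - Y \<in> sets borel" using A Y(1) Y' by auto
    have "measure M1 A = measure M1 (A \<inter> Y) + measure M1 (A \<inter> - Y)"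
      using M1.finite_measure_Union[OF _ _ disj] sets M(2) A_eq by simp
    moreover have "measure M2 A = measure M2 (A \<inter> Y) + measure M2 (A \<inter> - Y)"
      using M2.finite_measure_Union[OF _ _ disj] sets M(4) A_eq by simp
    ultimately show ?thesis using A sets by (simp add: \<nu>)
  qed
  \<comment> \<open>The equality of the two differences is encoded as one vanishing sum:
    \<open>P\<close> and \<open>M2\<close> carry the sign plus, \<open>N\<close> and
    \<open>M1\<close> the sign minus.\<close>
  define c where "c i = (if i < 2 then 1 else - 1 :: real)" for i :: nat
  define L where "L i = [P, M2, N, M1] ! i" for i
  have "(\<Sum>i\<in>{0,1,2,3}. c i * (\<integral>x. \<phi> x \<partial>L i)) = 0"
  proof (rule sum_integral_eq_0[where c = c and M = L and I = "{0,1,2,3}", OF _ _ _ \<phi>])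
    show "finite_measure (L i)" "sets (L i) = sets borel" if "i \<in> {0,1,2,3}" for i
      using that P(1,2) N(1,2) M by (auto simp: L_def)
    show "(\<Sum>i\<in>{0,1,2,3}. c i * measure (L i) A) = 0" if A: "A \<in> sets borel" for A
      using P(3)[OF A] N(3)[OF A] \<nu>[OF A] \<nu>_split[OF A] by (simp add: c_def L_def)
  qed
  then have "(\<integral>x. \<phi> x \<partial>P) - (\<integral>x. \<phi> x \<partial>N) = (\<integral>x. \<phi> x \<partial>M1) - (\<integral>x. \<phi> x \<partial>M2)"
    by (simp add: c_def L_def)
  then show ?thesis
    unfolding signed_measure_integral_def P_def[symmetric] N_def[symmetric]
    by (simp flip: of_real_diff)
qed

section \<open>Integration against projection-valued measures\<close>

lemma
  assumes "E \<in> projection_valued_measures"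
  shows pvm_projection: "A \<in> sets borel \<Longrightarrow> E A \<in> projections"
    and pvm_empty: "E {} = 0"
    and pvm_UNIV: "E UNIV = id_blinfun"
    and pvm_Int: "A \<in> sets borel \<Longrightarrow> B \<in> sets borel \<Longrightarrow> E (A \<inter> B) = E A o\<^sub>L E B"
    and pvm_sums: "range F \<subseteq> sets borel \<Longrightarrow> disjoint_family F \<Longrightarrow>
      (\<lambda>n. blinfun_apply (E (F n)) g) sums blinfun_apply (E (\<Union>n::nat. F n)) g"
  using assms unfolding projection_valued_measures_def by (auto simp: PiE_mem)

text \<open>This is the diagonal measure of \<open>E\<close> at \<open>g\<close>: for a projection,
  \<open>cinner (E A g) g\<close> is the squared norm of \<open>E A g\<close>, so an ordinary
  positive measure suffices.\<close>

definition spectral_measure ::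
    "('x::topological_space set \<Rightarrow> ('h::complex_hilbert \<Rightarrow>\<^sub>L 'h)) \<Rightarrow> 'h \<Rightarrow> 'x measure" where
  "spectral_measure E g = measure_of UNIV (sets borel) (\<lambda>A. ennreal ((norm (blinfun_apply (E A) g))\<^sup>2))"

lemma sets_spectral_measure: "sets (spectral_measure E g) = sets borel"
  unfolding spectral_measure_def by (metis sets.sets_measure_of_eq space_borel)

lemma emeasure_spectral_measure:
  assumes E: "E \<in> projection_valued_measures" and A: "A \<in> sets borel"
  shows "emeasure (spectral_measure E g) A = ennreal ((norm (blinfun_apply (E A) g))\<^sup>2)"
proof -
  have "countably_additive (sets borel) (\<lambda>A. ennreal ((norm (blinfun_apply (E A) g))\<^sup>2))"
    unfolding countably_additive_def
  proof (intro allI impI)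
    fix F :: "nat \<Rightarrow> 'a set"
    assume F: "range F \<subseteq> sets borel" "disjoint_family F" and U: "\<Union> (range F) \<in> sets borel"
    \<comment> \<open>In this form the mass is a continuous real-linear functional of
      \<open>E A g\<close>, through which strong countable additivity passes.\<close>
    have sq: "(norm (blinfun_apply (E A) g))\<^sup>2 = Re (cinner (blinfun_apply (E A) g) g)" if "A \<in> sets borel" for A
      using cinner_projection_self[OF pvm_projection[OF E that], of g] by simp
    have "bounded_linear (\<lambda>x. Re (cinner x g))"
      by (intro bounded_linear_compose[OF bounded_linear_Re]
          bounded_bilinear.bounded_linear_left[OF bounded_bilinear_cinner])
    from bounded_linear.sums[OF this pvm_sums[OF E F]]
    have "(\<lambda>n. (norm (blinfun_apply (E (F n)) g))\<^sup>2) sums (norm (blinfun_apply (E (\<Union>n. F n)) g))\<^sup>2"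
      using F(1) U by (simp add: sq range_subsetD)
    then show "(\<Sum>n. ennreal ((norm (blinfun_apply (E (F n)) g))\<^sup>2)) =
        ennreal ((norm (blinfun_apply (E (\<Union> (range F))) g))\<^sup>2)"
      by (intro suminf_ennreal_eq) auto
  qed
  moreover have "positive (sets borel) (\<lambda>A. ennreal ((norm (blinfun_apply (E A) g))\<^sup>2))"
    by (simp add: positive_def pvm_empty[OF E])
  ultimately show ?thesis
    unfolding spectral_measure_def
    using emeasure_measure_of_sigma[of UNIV "sets borel"] sets.sigma_algebra_axioms[of borel] A
    by simp
qed

lemma
  assumes E: "E \<in> projection_valued_measures"
  shows finite_spectral_measure: "finite_measure (spectral_measure E g)"
    and measure_spectral_measure: "A \<in> sets borel \<Longrightarrow>
      measure (spectral_measure E g) A = (norm (blinfun_apply (E A) g))\<^sup>2"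
    and measure_spectral_measure_UNIV: "measure (spectral_measure E g) UNIV = (norm g)\<^sup>2"
proof -
  show *: "measure (spectral_measure E g) A = (norm (blinfun_apply (E A) g))\<^sup>2" if "A \<in> sets borel" for A
    by (simp add: measure_def emeasure_spectral_measure[OF E that])
  show "measure (spectral_measure E g) UNIV = (norm g)\<^sup>2"
    by (simp add: * pvm_UNIV[OF E])
  have "space (spectral_measure E g) = UNIV"
    by (simp add: spectral_measure_def space_measure_of_conv)
  then show "finite_measure (spectral_measure E g)"
    by (intro finite_measureI) (simp add: emeasure_spectral_measure[OF E])
qed

text \<open>By polarization, the quadratic form against the positive measures \<open>\<parallel>E(\<cdot>) g\<parallel>\<^sup>2\<close> determines the
  sesquilinear form against the complex measures \<open>E\<^bsub>g,h\<^esub>\<close>.\<close>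

definition has_pvm_integral ::
    "('x::topological_space set \<Rightarrow> ('h::complex_hilbert \<Rightarrow>\<^sub>L 'h)) \<Rightarrow> ('x \<Rightarrow> real) \<Rightarrow> ('h \<Rightarrow>\<^sub>L 'h) \<Rightarrow> bool" where
  "has_pvm_integral E \<phi> T \<longleftrightarrow> T \<in> bounded_operators \<and>
     (\<forall>g. cinner (blinfun_apply T g) g = of_real (\<integral>x. \<phi> x \<partial>spectral_measure E g))"

text \<open>Polarizing \<open>E A\<close> and \<open>T\<close> with the same four vectors expresses
  both the complex measure and the sesquilinear form of \<open>T\<close> through diagonal data,
  where they agree by hypothesis. The sesquilinear form determines the operator, which settles the
  definite description.\<close>

lemma pvm_integral_eqI:
  assumes E: "E \<in> projection_valued_measures"
    and \<phi>: "\<phi> \<in> borel_measurable borel" "bounded (range \<phi>)"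
    and T: "has_pvm_integral E \<phi> T"
  shows "pvm_integral E (\<lambda>x. of_real (\<phi> x)) = T"
proof -
  have T_op: "T \<in> bounded_operators"
    and T_diag: "\<And>g. cinner (blinfun_apply T g) g = of_real (\<integral>x. \<phi> x \<partial>spectral_measure E g)"
    using T by (auto simp: has_pvm_integral_def)
  note M = finite_spectral_measure[OF E] sets_spectral_measure[of E]
  have E_pol: "Re (cinner (blinfun_apply (E A) g) h) = measure (spectral_measure E ((1/2) *\<^sub>R (g + h))) A
        - measure (spectral_measure E ((1/2) *\<^sub>R (g - h))) A"
      "Im (cinner (blinfun_apply (E A) g) h) = measure (spectral_measure E ((1/2) *\<^sub>R (g + \<i> *\<^sub>C h))) A
        - measure (spectral_measure E ((1/2) *\<^sub>R (g - \<i> *\<^sub>C h))) A"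
    if A: "A \<in> sets borel" for A g h
  proof -
    have P: "E A \<in> projections" by (rule pvm_projection[OF E A])
    then have B: "E A \<in> bounded_operators" by (simp add: projections_iff)
    show "Re (cinner (blinfun_apply (E A) g) h) = measure (spectral_measure E ((1/2) *\<^sub>R (g + h))) A
        - measure (spectral_measure E ((1/2) *\<^sub>R (g - h))) A"
      unfolding measure_spectral_measure[OF E A]
      by (rule Re_polarization[OF B cinner_projection_self[OF P]])
    show "Im (cinner (blinfun_apply (E A) g) h) = measure (spectral_measure E ((1/2) *\<^sub>R (g + \<i> *\<^sub>C h))) A
        - measure (spectral_measure E ((1/2) *\<^sub>R (g - \<i> *\<^sub>C h))) A"
      unfolding measure_spectral_measure[OF E A]
      by (rule Im_polarization[OF B cinner_projection_self[OF P]])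
  qed
  have T_eq: "cinner (blinfun_apply T g) h =
      complex_measure_integral borel (\<lambda>A. cinner (blinfun_apply (E A) g) h) (\<lambda>x. of_real (\<phi> x))" for g h
  proof -
    have "signed_measure_integral borel (\<lambda>A. Re (cinner (blinfun_apply (E A) g) h)) (\<lambda>x. of_real (\<phi> x)) =
        of_real ((\<integral>x. \<phi> x \<partial>spectral_measure E ((1/2) *\<^sub>R (g + h))) -
          (\<integral>x. \<phi> x \<partial>spectral_measure E ((1/2) *\<^sub>R (g - h))))"
      by (rule signed_measure_integral_diff[OF M M E_pol(1) \<phi>])
    moreover have "signed_measure_integral borel (\<lambda>A. Im (cinner (blinfun_apply (E A) g) h))
        (\<lambda>x. of_real (\<phi> x)) =
        of_real ((\<integral>x. \<phi> x \<partial>spectral_measure E ((1/2) *\<^sub>R (g + \<i> *\<^sub>C h))) -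
          (\<integral>x. \<phi> x \<partial>spectral_measure E ((1/2) *\<^sub>R (g - \<i> *\<^sub>C h))))"
      by (rule signed_measure_integral_diff[OF M M E_pol(2) \<phi>])
    ultimately show ?thesis
      by (simp add: complex_eq_iff complex_measure_integral_def
          Re_polarization[OF T_op T_diag] Im_polarization[OF T_op T_diag])
  qed
  show ?thesis
    unfolding pvm_integral_def
  proof (rule the_equality)
    fix T'
    assume "T' \<in> bounded_operators \<and> (\<forall>g h. cinner (blinfun_apply T' g) h =
      complex_measure_integral borel (\<lambda>\<Delta>. cinner (blinfun_apply (E \<Delta>) g) h) (\<lambda>x. of_real (\<phi> x)))"
    then show "T' = T"
      by (intro blinfun_eqI cinner_eqI_left) (simp add: T_eq)
  qed (use T_op T_eq in auto)
qed

section \<open>Linearity, norm bound and existence of the integral\<close>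

lemma has_pvm_integral_lin:
  assumes E: "E \<in> projection_valued_measures"
    and u: "u \<in> borel_measurable borel" "bounded (range u)" "has_pvm_integral E u T"
    and v: "v \<in> borel_measurable borel" "bounded (range v)" "has_pvm_integral E v T'"
  shows "has_pvm_integral E (\<lambda>x. a * u x + v x) (a *\<^sub>R T + T')"
  unfolding has_pvm_integral_def
proof (intro conjI allI)
  show "a *\<^sub>R T + T' \<in> bounded_operators"
    using u(3) v(3) by (auto simp: has_pvm_integral_def)
  fix g
  note M = finite_spectral_measure[OF E, of g] sets_spectral_measure[of E g]
  have "(\<integral>x. a * u x + v x \<partial>spectral_measure E g) =
      a * (\<integral>x. u x \<partial>spectral_measure E g) + (\<integral>x. v x \<partial>spectral_measure E g)"
    using integrable_bounded_measurable[OF M u(1,2)] integrable_bounded_measurable[OF M v(1,2)] by simp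
  then show "cinner (blinfun_apply (a *\<^sub>R T + T') g) g =
      of_real (\<integral>x. a * u x + v x \<partial>spectral_measure E g)"
    using u(3) v(3)
    by (simp add: has_pvm_integral_def blinfun.add_left blinfun.scaleR_left cinner_add_left cinner_scaleR_left)
qed

lemma has_pvm_integral_const:
  assumes E: "E \<in> projection_valued_measures"
  shows "has_pvm_integral E (\<lambda>x. c) (c *\<^sub>R id_blinfun)"
proof -
  have "space (spectral_measure E g) = UNIV" for g
    using sets_eq_imp_space_eq[OF sets_spectral_measure[of E g]] by simp
  then show ?thesis
    by (auto simp: has_pvm_integral_def blinfun.scaleR_left cinner_scaleR_left cinner_self
        measure_spectral_measure_UNIV[OF E])
qed

text \<open>The spectral measure at \<open>g\<close> has total mass the squared norm of
  \<open>g\<close>, so the quadratic form of \<open>T\<close> is bounded by \<open>C\<close> times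
  that.\<close>

lemma has_pvm_integral_norm_le:
  assumes E: "E \<in> projection_valued_measures" and \<phi>: "\<phi> \<in> borel_measurable borel"
    and T: "has_pvm_integral E \<phi> T" and C: "\<And>x. \<bar>\<phi> x\<bar> \<le> C"
  shows "norm T \<le> C"
proof (rule norm_le_of_quadratic_form)
  show "T \<in> bounded_operators"
    "cinner (blinfun_apply T g) g = of_real (\<integral>x. \<phi> x \<partial>spectral_measure E g)" for g
    using T by (auto simp: has_pvm_integral_def)
  show "\<bar>\<integral>x. \<phi> x \<partial>spectral_measure E g\<bar> \<le> C * (norm g)\<^sup>2" for g
    using abs_integral_le[OF finite_spectral_measure[OF E, of g] sets_spectral_measure \<phi> C]
    by (simp add: measure_spectral_measure_UNIV[OF E])
  show "0 \<le> C" using C abs_ge_zero order_trans by blast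
qed

text \<open>Limits are taken in the space of real-linear maps, so complex linearity has to be
  carried over; it survives because it can be tested on inner products.\<close>

lemma bounded_operators_limit:
  assumes T: "\<And>n. T n \<in> bounded_operators" and lim: "T \<longlonglongrightarrow> (L :: 'h::complex_hilbert \<Rightarrow>\<^sub>L 'h)"
  shows "L \<in> bounded_operators"
proof -
  have "blinfun_apply L (c *\<^sub>C x) = c *\<^sub>C blinfun_apply L x" for c x
  proof (rule cinner_eqI_left)
    fix z
    have lim_x: "(\<lambda>n. cinner (blinfun_apply (T n) x) z) \<longlonglongrightarrow> cinner (blinfun_apply L x) z" for x
      by (intro tendsto_cinner blinfun.tendsto lim tendsto_const)
    have "(\<lambda>n. cinner (blinfun_apply (T n) (c *\<^sub>C x)) z) \<longlonglongrightarrow> c * cinner (blinfun_apply L x) z"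
      unfolding bounded_operators_scaleC[OF T] cinner_scaleC_left
      by (intro tendsto_mult_left lim_x)
    then show "cinner (blinfun_apply L (c *\<^sub>C x)) z = cinner (c *\<^sub>C blinfun_apply L x) z"
      using LIMSEQ_unique[OF lim_x] by (simp add: cinner_scaleC_left)
  qed
  then show ?thesis by (simp add: bounded_operators_def)
qed

lemma ex_has_pvm_integral:
  assumes E: "E \<in> projection_valued_measures"
    and \<phi>: "\<phi> \<in> borel_measurable borel" "bounded (range \<phi>)"
  shows "\<exists>T. has_pvm_integral E \<phi> T"
  using \<phi>
proof (induction rule: bounded_measurable_induct)
  case (indicator A)
  have "space (spectral_measure E g) = UNIV" for g
    using sets_eq_imp_space_eq[OF sets_spectral_measure[of E g]] by simp
  then have "has_pvm_integral E (indicat_real A) (E A)"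
    using pvm_projection[OF E indicator] indicator
    by (simp add: has_pvm_integral_def cinner_projection_self sets_spectral_measure
        measure_spectral_measure[OF E indicator]) (simp add: projections_iff)
  then show ?case ..
next
  case (lin a u v)
  then show ?case using has_pvm_integral_lin[OF E] by blast
next
  case (lim u v)
  obtain T where T: "\<And>n. has_pvm_integral E (u n) (T n)" using lim.IH by metis
  have "Cauchy T"
  proof (rule metric_CauchyI)
    fix e :: real assume "0 < e"
    then obtain N where N: "\<And>n x. n \<ge> N \<Longrightarrow> \<bar>u n x - v x\<bar> < e / 4"
      using lim.hyps(5) unfolding uniform_limit_sequentially_iff dist_real_def
      by (metis divide_pos_pos UNIV_I zero_less_numeral)
    show "\<exists>N. \<forall>m\<ge>N. \<forall>n\<ge>N. dist (T m) (T n) < e"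
    proof (intro exI allI impI)
      fix m n assume mn: "m \<ge> N" "n \<ge> N"
      \<comment> \<open>The difference is written as a linear combination to match
        \<open>has_pvm_integral_lin\<close>; two errors below \<open>e / 4\<close> give
        \<open>e / 2\<close>, leaving room for the strict inequality.\<close>
      have "norm ((- 1) *\<^sub>R T n + T m) \<le> e / 2"
      proof (rule has_pvm_integral_norm_le[OF E])
        show "has_pvm_integral E (\<lambda>x. (- 1) * u n x + u m x) ((- 1) *\<^sub>R T n + T m)"
          by (intro has_pvm_integral_lin E lim.hyps T)
        show "(\<lambda>x. (- 1) * u n x + u m x) \<in> borel_measurable borel"
          by (intro borel_measurable_add borel_measurable_times borel_measurable_const lim.hyps)
        show "\<bar>(- 1) * u n x + u m x\<bar> \<le> e / 2" for x
          using N[OF mn(1), of x] N[OF mn(2), of x] by linarith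
      qed
      then show "dist (T m) (T n) < e"
        using \<open>0 < e\<close> by (simp add: dist_norm)
    qed
  qed
  then obtain L where L: "T \<longlonglongrightarrow> L" using Cauchy_convergent_iff convergent_def by blast
  have "L \<in> bounded_operators"
    using T by (intro bounded_operators_limit[OF _ L]) (simp add: has_pvm_integral_def)
  moreover have "cinner (blinfun_apply L g) g = of_real (\<integral>x. v x \<partial>spectral_measure E g)" for g
  proof -
    have "(\<lambda>n. cinner (blinfun_apply (T n) g) g) \<longlonglongrightarrow> cinner (blinfun_apply L g) g"
      by (intro tendsto_cinner blinfun.tendsto L tendsto_const)
    moreover have "(\<lambda>n. complex_of_real (\<integral>x. u n x \<partial>spectral_measure E g)) \<longlonglongrightarrow>
        of_real (\<integral>x. v x \<partial>spectral_measure E g)"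
      by (intro tendsto_of_real tendsto_integral_uniform_limit finite_spectral_measure[OF E]
          sets_spectral_measure lim.hyps)
    ultimately show ?thesis
      using T LIMSEQ_unique by (simp add: has_pvm_integral_def)
  qed
  ultimately show ?case by (auto simp: has_pvm_integral_def)
qed

section \<open>Operators satisfying the Cuntz relations\<close>

locale cuntz_family =
  fixes N :: nat and S :: "nat \<Rightarrow> ('h::complex_hilbert \<Rightarrow>\<^sub>L 'h)"
  assumes S_in_bounded_operators: "i < N \<Longrightarrow> S i \<in> bounded_operators"
    and cuntz: "cuntz_relations N S"
begin

text \<open>Under the identification of the space with \<open>N\<close> orthogonal copies of itself
  through the isometries \<open>S i\<close>, this is the block-diagonal operator with blocks
  \<open>A i\<close>.\<close>

definition amplify :: "(nat \<Rightarrow> ('h \<Rightarrow>\<^sub>L 'h)) \<Rightarrow> ('h \<Rightarrow>\<^sub>L 'h)" where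
  "amplify A = (\<Sum>i<N. S i o\<^sub>L A i o\<^sub>L adj (S i))"

lemma amplify_apply:
  "blinfun_apply (amplify A) g = (\<Sum>i<N. blinfun_apply (S i) (blinfun_apply (A i) (blinfun_apply (adj (S i)) g)))"
  by (simp add: amplify_def blinfun.sum_left)

lemma adj_apply_S:
  assumes "i < N" "j < N"
  shows "blinfun_apply (adj (S i)) (blinfun_apply (S j) x) = (if i = j then x else 0)"
proof -
  have "adj (S i) o\<^sub>L S j = (if i = j then id_blinfun else 0)"
    using cuntz assms by (simp add: cuntz_relations_def)
  from arg_cong[OF this, of "\<lambda>T. blinfun_apply T x"] show ?thesis by (simp split: if_splits)
qed

lemma amplify_id: "amplify (\<lambda>i. id_blinfun) = id_blinfun"
proof -
  have "S i o\<^sub>L id_blinfun o\<^sub>L adj (S i) = S i o\<^sub>L adj (S i)" for i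
    by (rule blinfun_eqI) simp
  then show ?thesis
    using cuntz by (simp add: amplify_def cuntz_relations_def)
qed

text \<open>Orthogonality of the ranges kills all terms but the \<open>i\<close>-th, so
  \<open>adj (S i)\<close> reads off the \<open>i\<close>-th block.\<close>

lemma adj_amplify:
  assumes "i < N"
  shows "blinfun_apply (adj (S i)) (blinfun_apply (amplify A) g) = blinfun_apply (A i) (blinfun_apply (adj (S i)) g)"
  using assms by (simp add: amplify_apply blinfun.sum_right adj_apply_S)

lemma amplify_comp: "amplify A o\<^sub>L amplify B = amplify (\<lambda>i. A i o\<^sub>L B i)"
  by (rule blinfun_eqI) (simp add: amplify_apply[of A] amplify_apply[of "\<lambda>i. A i o\<^sub>L B i"] adj_amplify)

lemma amplify_diff: "amplify (\<lambda>i. A i - B i) = amplify A - amplify B"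
  by (rule blinfun_eqI)
    (simp add: amplify_apply blinfun.diff_left blinfun.diff_right sum_subtractf)

lemma amplify_in_bounded_operators:
  "(\<And>i. i < N \<Longrightarrow> A i \<in> bounded_operators) \<Longrightarrow> amplify A \<in> bounded_operators"
  unfolding amplify_def
  by (intro sum_in_bounded_operators comp_in_bounded_operators adj_in_bounded_operators
      S_in_bounded_operators) auto

lemma cinner_amplify_left:
  "cinner (blinfun_apply (amplify A) g) h =
    (\<Sum>i<N. cinner (blinfun_apply (A i) (blinfun_apply (adj (S i)) g)) (blinfun_apply (adj (S i)) h))"
  by (simp add: amplify_apply cinner_sum_left cinner_adj_right S_in_bounded_operators)

lemma cinner_amplify_right:
  "cinner g (blinfun_apply (amplify A) h) =
    (\<Sum>i<N. cinner (blinfun_apply (adj (S i)) g) (blinfun_apply (A i) (blinfun_apply (adj (S i)) h)))"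
  by (simp add: amplify_apply cinner_sum_right cinner_adj_left S_in_bounded_operators)

text \<open>Parseval's identity for the decomposition into the ranges of the \<open>S i\<close>,
  obtained by pairing \<open>amplify_id\<close> with \<open>g\<close>.\<close>

lemma sum_norm_adj: "(\<Sum>i<N. (norm (blinfun_apply (adj (S i)) g))\<^sup>2) = (norm g)\<^sup>2"
  using arg_cong[OF cinner_amplify_left[of "\<lambda>i. id_blinfun" g g], of Re]
  by (simp add: amplify_id cinner_self)

text \<open>Parseval's identity for the image and for \<open>g\<close> reduces the estimate to the
  single blocks.\<close>

lemma norm_amplify_le:
  assumes le: "\<And>i. i < N \<Longrightarrow> norm (A i) \<le> c" and "0 \<le> c"
  shows "norm (amplify A) \<le> c"
proof (rule norm_blinfun_bound[OF \<open>0 \<le> c\<close>])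
  fix g
  have "(norm (blinfun_apply (amplify A) g))\<^sup>2 =
      (\<Sum>i<N. (norm (blinfun_apply (A i) (blinfun_apply (adj (S i)) g)))\<^sup>2)"
    by (simp add: adj_amplify flip: sum_norm_adj[of "blinfun_apply (amplify A) g"])
  also have "\<dots> \<le> (\<Sum>i<N. (c * norm (blinfun_apply (adj (S i)) g))\<^sup>2)"
    by (intro sum_mono power_mono order_trans[OF norm_blinfun] mult_right_mono le) auto
  also have "\<dots> = (c * norm g)\<^sup>2"
    by (simp add: power_mult_distrib sum_norm_adj flip: sum_distrib_left)
  finally show "norm (blinfun_apply (amplify A) g) \<le> c * norm g"
    by (rule power2_le_imp_le) (simp add: \<open>0 \<le> c\<close>)
qed

lemma amplify_in_projections:
  assumes "\<And>i. i < N \<Longrightarrow> P i \<in> projections"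
  shows "amplify P \<in> projections"
proof -
  have "amplify (\<lambda>i. P i o\<^sub>L P i) = amplify P"
    unfolding amplify_def using assms by (simp add: projections_iff)
  then show ?thesis
    using assms amplify_in_bounded_operators[of P]
    by (simp add: projections_iff amplify_comp cinner_amplify_left cinner_amplify_right)
qed

section \<open>The map \<open>pvm_map\<close> and integration against its values\<close>

context
  fixes \<sigma>s :: "nat \<Rightarrow> 'x::topological_space \<Rightarrow> 'x"
  assumes \<sigma>s: "\<And>i. i < N \<Longrightarrow> \<sigma>s i \<in> borel_measurable borel"
begin

lemma vimage_borel: "i < N \<Longrightarrow> A \<in> sets borel \<Longrightarrow> \<sigma>s i -` A \<in> sets borel"
  using measurable_sets[OF \<sigma>s] by fastforce

lemma pvm_map_eq: "A \<in> sets borel \<Longrightarrow> pvm_map N \<sigma>s S E A = amplify (\<lambda>i. E (\<sigma>s i -` A))"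
  by (simp add: pvm_map_def amplify_def)

text \<open>Preimages commute with the set operations and \<open>amplify\<close> respects products,
  projections and the identity, so each axiom is inherited blockwise; strong convergence survives
  applying \<open>S i\<close> and summing finitely often.\<close>

lemma pvm_map_in_pvm:
  assumes E: "E \<in> projection_valued_measures"
  shows "pvm_map N \<sigma>s S E \<in> projection_valued_measures"
  unfolding projection_valued_measures_def mem_Collect_eq
proof (intro conjI ballI allI impI)
  show "pvm_map N \<sigma>s S E \<in> sets borel \<rightarrow>\<^sub>E projections"
  proof (rule PiE_I)
    show "pvm_map N \<sigma>s S E A \<in> projections" if "A \<in> sets borel" for A
      using that by (auto simp: pvm_map_eq intro!: amplify_in_projections pvm_projection[OF E] vimage_borel)
  qed (simp add: pvm_map_def)
  show "pvm_map N \<sigma>s S E {} = 0"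
    by (simp add: pvm_map_eq pvm_empty[OF E] amplify_def)
  show "pvm_map N \<sigma>s S E UNIV = id_blinfun"
    by (simp add: pvm_map_eq pvm_UNIV[OF E] amplify_id)
  show "pvm_map N \<sigma>s S E (A \<inter> B) = pvm_map N \<sigma>s S E A o\<^sub>L pvm_map N \<sigma>s S E B"
    if "A \<in> sets borel" "B \<in> sets borel" for A B
    using that
    by (simp add: pvm_map_eq amplify_comp) (simp add: amplify_def pvm_Int[OF E] vimage_borel)
  show "(\<lambda>n. blinfun_apply (pvm_map N \<sigma>s S E (F n)) g) sums blinfun_apply (pvm_map N \<sigma>s S E (\<Union>n. F n)) g"
    if F: "range F \<subseteq> sets borel" "disjoint_family F" for F :: "nat \<Rightarrow> 'x set" and g
  proof -
    have "(\<lambda>n. blinfun_apply (E (\<sigma>s i -` F n)) x) sums blinfun_apply (E (\<sigma>s i -` (\<Union>n. F n))) x"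
      if i: "i < N" for i x
      unfolding vimage_UN using F vimage_borel[OF i]
      by (intro pvm_sums[OF E]) (auto simp: disjoint_family_on_def)
    moreover have "F n \<in> sets borel" for n using F(1) by auto
    moreover have "(\<Union>n. F n) \<in> sets borel" using F(1) by auto
    ultimately show ?thesis
      by (simp only: pvm_map_eq amplify_apply)
        (intro sums_sum bounded_linear.sums[OF blinfun.bounded_linear_right], simp)
  qed
qed

text \<open>The spectral measure of the image at \<open>g\<close> is the sum of the push-forwards
  under \<open>\<sigma>s i\<close> of the spectral measures of \<open>E\<close> at
  \<open>adj (S i) g\<close>. Change of variables then matches the blocks of
  \<open>amplify T\<close>.\<close>

lemma has_pvm_integral_pvm_map:
  assumes E: "E \<in> projection_valued_measures"
    and \<phi>: "\<phi> \<in> borel_measurable borel" "bounded (range \<phi>)"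
    and T: "\<And>i. i < N \<Longrightarrow> has_pvm_integral E (\<lambda>x. \<phi> (\<sigma>s i x)) (T i)"
  shows "has_pvm_integral (pvm_map N \<sigma>s S E) \<phi> (amplify T)"
  unfolding has_pvm_integral_def
proof (intro conjI allI)
  show "amplify T \<in> bounded_operators"
    using T by (intro amplify_in_bounded_operators) (simp add: has_pvm_integral_def)
  fix g
  note E' = pvm_map_in_pvm[OF E]
  \<comment> \<open>Indices below \<open>N\<close> hold the push-forwards; the extra index
    \<open>N\<close>, with coefficient minus one, holds the spectral measure of the image. The
    identity thus becomes a vanishing sum over \<open>{..N}\<close>.\<close>
  define L where "L i = (if i < N then distr (spectral_measure E (blinfun_apply (adj (S i)) g)) borel (\<sigma>s i)
    else spectral_measure (pvm_map N \<sigma>s S E) g)" for i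
  define c where "c i = (if i < N then 1 else - 1 :: real)" for i
  have meas: "\<sigma>s i \<in> measurable (spectral_measure E h) borel" if "i < N" for i h
    using \<sigma>s[OF that] by (simp only: measurable_cong_sets[OF sets_spectral_measure refl])
  have L_measure: "measure (L i) A = (norm (blinfun_apply (E (\<sigma>s i -` A)) (blinfun_apply (adj (S i)) g)))\<^sup>2"
    if "i < N" "A \<in> sets borel" for i A
  proof -
    have "space (spectral_measure E h) = UNIV" for h
      using sets_eq_imp_space_eq[OF sets_spectral_measure[of E h]] by simp
    then show ?thesis
      using that by (simp add: L_def measure_distr meas measure_spectral_measure[OF E] vimage_borel)
  qed
  have "(\<Sum>i\<le>N. c i * (\<integral>x. \<phi> x \<partial>L i)) = 0"
  proof (rule sum_integral_eq_0[where c = c and M = L and I = "{..N}", OF _ _ _ \<phi>])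
    show "finite_measure (L i)" for i
      by (simp add: L_def finite_spectral_measure[OF E']
          finite_measure.finite_measure_distr[OF finite_spectral_measure[OF E] meas])
    show "sets (L i) = sets borel" for i
      by (simp add: L_def sets_spectral_measure)
    show "(\<Sum>i\<le>N. c i * measure (L i) A) = 0" if A: "A \<in> sets borel" for A
    proof -
      have "measure (L N) A = Re (cinner (blinfun_apply (pvm_map N \<sigma>s S E A) g) g)"
        by (simp add: L_def measure_spectral_measure[OF E' A] cinner_projection_self pvm_projection[OF E' A])
      also have "\<dots> = (\<Sum>i<N. measure (L i) A)"
        by (simp add: pvm_map_eq A cinner_amplify_left L_measure cinner_projection_self
            pvm_projection[OF E] vimage_borel)
      finally show ?thesis
        by (simp add: c_def flip: lessThan_Suc_atMost)
    qed
  qed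
  moreover have "(\<integral>x. \<phi> x \<partial>L i) = (\<integral>x. \<phi> (\<sigma>s i x) \<partial>spectral_measure E (blinfun_apply (adj (S i)) g))"
    if "i < N" for i
    using that by (simp add: L_def integral_distr[OF meas \<phi>(1)])
  ultimately have "(\<integral>x. \<phi> x \<partial>spectral_measure (pvm_map N \<sigma>s S E) g) =
      (\<Sum>i<N. \<integral>x. \<phi> (\<sigma>s i x) \<partial>spectral_measure E (blinfun_apply (adj (S i)) g))"
    by (simp add: c_def L_def flip: lessThan_Suc_atMost)
  then show "cinner (blinfun_apply (amplify T) g) g =
      of_real (\<integral>x. \<phi> x \<partial>spectral_measure (pvm_map N \<sigma>s S E) g)"
    using T by (simp add: cinner_amplify_left has_pvm_integral_def)
qed

end

end

section \<open>The contraction\<close>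

lemma Lip1_borel_bounded:
  fixes \<phi> :: "'x::metric_space \<Rightarrow> real"
  assumes "compact (UNIV :: 'x set)" "\<phi> \<in> Lip1"
  shows "\<phi> \<in> borel_measurable borel" "bounded (range \<phi>)"
proof -
  have "1-lipschitz_on UNIV \<phi>"
    using assms(2) by (intro lipschitz_onI) (auto simp: Lip1_def dist_real_def)
  then have "continuous_on UNIV \<phi>" by (rule lipschitz_on_continuous_on)
  then show "\<phi> \<in> borel_measurable borel" "bounded (range \<phi>)"
    using assms(1) by (auto intro: borel_measurable_continuous_onI compact_imp_bounded compact_continuous_image)
qed

text \<open>Existence and uniqueness together let \<open>pvm_integral\<close> be used as a genuine
  integral.\<close>

lemma has_pvm_integral_pvm_integral:
  assumes "E \<in> projection_valued_measures" "\<phi> \<in> borel_measurable borel" "bounded (range \<phi>)"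
  shows "has_pvm_integral E \<phi> (pvm_integral E (\<lambda>x. of_real (\<phi> x)))"
  using ex_has_pvm_integral[OF assms] pvm_integral_eqI[OF assms] by metis

text \<open>Subtracting the constant \<open>\<phi> x\<^sub>0\<close> leaves the difference of the integrals unchanged and makes
  \<open>\<bar>\<phi>\<bar>\<close> at most the diameter.\<close>

lemma bdd_above_pvm_dist:
  fixes E F :: "'x::metric_space set \<Rightarrow> ('h::complex_hilbert \<Rightarrow>\<^sub>L 'h)"
  assumes X: "compact (UNIV :: 'x set)"
    and E: "E \<in> projection_valued_measures" and F: "F \<in> projection_valued_measures"
  shows "bdd_above ((\<lambda>\<phi>. norm (pvm_integral E (\<lambda>x. complex_of_real (\<phi> x)) -
    pvm_integral F (\<lambda>x. complex_of_real (\<phi> x)))) ` Lip1)"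
proof (rule bdd_aboveI2)
  fix \<phi> :: "'x \<Rightarrow> real" assume \<phi>: "\<phi> \<in> Lip1"
  note \<phi>' = Lip1_borel_bounded[OF X \<phi>]
  \<comment> \<open>An arbitrary base point. The constant integrates to the same multiple of the
    identity for both measures, so it cancels in the difference.\<close>
  define x0 :: 'x where "x0 = undefined"
  have bound: "norm (pvm_integral G (\<lambda>x. complex_of_real (\<phi> x)) - \<phi> x0 *\<^sub>R id_blinfun) \<le> diameter (UNIV :: 'x set)"
    if G: "G \<in> projection_valued_measures" for G :: "'x set \<Rightarrow> ('h \<Rightarrow>\<^sub>L 'h)"
  proof (rule has_pvm_integral_norm_le[OF G])
    have "has_pvm_integral G (\<lambda>x. 1 * \<phi> x + - \<phi> x0)
        (1 *\<^sub>R pvm_integral G (\<lambda>x. of_real (\<phi> x)) + (- \<phi> x0) *\<^sub>R id_blinfun)"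
      by (intro has_pvm_integral_lin has_pvm_integral_pvm_integral has_pvm_integral_const G \<phi>')
        auto
    then show "has_pvm_integral G (\<lambda>x. \<phi> x - \<phi> x0)
        (pvm_integral G (\<lambda>x. of_real (\<phi> x)) - \<phi> x0 *\<^sub>R id_blinfun)"
      by simp
    show "(\<lambda>x. \<phi> x - \<phi> x0) \<in> borel_measurable borel" using \<phi>'(1) by measurable
    show "\<bar>\<phi> x - \<phi> x0\<bar> \<le> diameter (UNIV :: 'x set)" for x
      using \<phi> diameter_bounded_bound[OF compact_imp_bounded[OF X], of x x0]
      by (auto simp: Lip1_def intro: order_trans)
  qed
  show "norm (pvm_integral E (\<lambda>x. complex_of_real (\<phi> x)) - pvm_integral F (\<lambda>x. complex_of_real (\<phi> x)))
      \<le> 2 * diameter (UNIV :: 'x set)"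
    using bound[OF E] bound[OF F] norm_triangle_ineq4[of
        "pvm_integral E (\<lambda>x. complex_of_real (\<phi> x)) - \<phi> x0 *\<^sub>R id_blinfun"
        "pvm_integral F (\<lambda>x. complex_of_real (\<phi> x)) - \<phi> x0 *\<^sub>R id_blinfun"]
    by simp
qed

theorem theorem2p15:
  fixes N :: nat
    and \<sigma>s :: "nat \<Rightarrow> 'x::metric_space \<Rightarrow> 'x"
    and \<sigma> :: "'x \<Rightarrow> 'x"
    and S :: "nat \<Rightarrow> ('h::complex_hilbert \<Rightarrow>\<^sub>L 'h)"
  assumes "compact (UNIV :: 'x set)"
    and "\<And>i. i < N \<Longrightarrow> lipschitz_contraction UNIV dist (\<sigma>s i)"
    and "\<sigma> \<in> borel_measurable borel"
    and "\<And>i. i < N \<Longrightarrow> \<sigma> \<circ> \<sigma>s i = id"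
    and "(\<Union>i<N. range (\<sigma>s i)) = UNIV"
    and "disjoint_family_on (\<lambda>i. range (\<sigma>s i)) {..<N}"
    and "\<And>i. i < N \<Longrightarrow> S i \<in> bounded_operators"
    and "cuntz_relations N S"
  shows "lipschitz_contraction projection_valued_measures pvm_dist (pvm_map N \<sigma>s S)"
proof -
  interpret cuntz_family N S using assms(7,8) by unfold_locales
  note X = assms(1)
  have "\<exists>r. 0 < r \<and> r < 1 \<and> (\<forall>x y. dist (\<sigma>s i x) (\<sigma>s i y) \<le> r * dist x y)" if "i < N" for i
    using assms(2)[OF that] by (simp add: lipschitz_contraction_def)
  then obtain r where r: "\<And>i. i < N \<Longrightarrow> 0 < r i" "\<And>i. i < N \<Longrightarrow> r i < 1"
    "\<And>i x y. i < N \<Longrightarrow> dist (\<sigma>s i x) (\<sigma>s i y) \<le> r i * dist x y" by metis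
  have \<sigma>s: "\<sigma>s i \<in> borel_measurable borel" if "i < N" for i
  proof -
    have "(r i)-lipschitz_on UNIV (\<sigma>s i)"
      using r that by (intro lipschitz_onI) (auto intro: less_imp_le)
    then show ?thesis
      by (intro borel_measurable_continuous_onI lipschitz_on_continuous_on)
  qed
  \<comment> \<open>An empty union could not cover the nonempty space.\<close>
  have "0 < N" using assms(5) by (cases N) auto
  define R where "R = Max (r ` {..<N})"
  \<comment> \<open>The maximum is attained, so it inherits strict bounds from a single
    ratio.\<close>
  have "R \<in> r ` {..<N}" unfolding R_def using \<open>0 < N\<close> by (intro Max_in) auto
  then have R: "0 < R" "R < 1" using r by auto
  have r_le: "r i \<le> R" if "i < N" for i unfolding R_def using that by simp
  have "pvm_dist (pvm_map N \<sigma>s S E) (pvm_map N \<sigma>s S F) \<le> R * pvm_dist E F"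
    if E: "E \<in> projection_valued_measures" and F: "F \<in> projection_valued_measures"
    for E F :: "'x set \<Rightarrow> ('h \<Rightarrow>\<^sub>L 'h)"
    unfolding pvm_dist_def[of "pvm_map N \<sigma>s S E"]
  proof (rule cSUP_least)
    show "Lip1 \<noteq> ({} :: ('x \<Rightarrow> real) set)" by (auto simp: Lip1_def intro!: exI[of _ "\<lambda>_. 0"])
    fix \<phi> :: "'x \<Rightarrow> real" assume \<phi>: "\<phi> \<in> Lip1"
    note \<phi>' = Lip1_borel_bounded[OF X \<phi>]
    \<comment> \<open>Division by \<open>R\<close> makes the \<open>R\<close>-Lipschitz function
      \<open>\<phi> \<circ> \<sigma>s i\<close> a competitor in the supremum
      \<open>pvm_dist E F\<close>; \<open>I\<close> restores the factor, which becomes the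
      contraction constant.\<close>
    define \<psi> where "\<psi> i x = \<phi> (\<sigma>s i x) / R" for i x
    define I where "I G i = R *\<^sub>R pvm_integral G (\<lambda>x. complex_of_real (\<psi> i x))"
      for G :: "'x set \<Rightarrow> ('h \<Rightarrow>\<^sub>L 'h)" and i
    have \<psi>: "\<psi> i \<in> Lip1" if "i < N" for i
    proof -
      have "\<bar>\<phi> (\<sigma>s i x) - \<phi> (\<sigma>s i y)\<bar> \<le> R * dist x y" for x y
      proof -
        have "\<bar>\<phi> (\<sigma>s i x) - \<phi> (\<sigma>s i y)\<bar> \<le> dist (\<sigma>s i x) (\<sigma>s i y)"
          using \<phi> by (simp add: Lip1_def)
        also have "\<dots> \<le> r i * dist x y" by (rule r(3)[OF that])
        also have "\<dots> \<le> R * dist x y" by (rule mult_right_mono[OF r_le[OF that]]) simp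
        finally show ?thesis .
      qed
      then show ?thesis
        using R(1) by (simp add: Lip1_def \<psi>_def field_simps flip: diff_divide_distrib)
    qed
    have I: "pvm_integral (pvm_map N \<sigma>s S G) (\<lambda>x. complex_of_real (\<phi> x)) = amplify (I G)"
      if G: "G \<in> projection_valued_measures" for G
    proof (intro pvm_integral_eqI pvm_map_in_pvm has_pvm_integral_pvm_map \<sigma>s G \<phi>')
      fix i assume "i < N"
      note \<psi>i = Lip1_borel_bounded[OF X \<psi>[OF this]]
      \<comment> \<open>The zero constant is added to obtain scaling by \<open>R\<close> from
        \<open>has_pvm_integral_lin\<close>.\<close>
      have "has_pvm_integral G (\<lambda>x. R * \<psi> i x + 0) (I G i + 0 *\<^sub>R id_blinfun)"
        unfolding I_def
        by (intro has_pvm_integral_lin has_pvm_integral_pvm_integral has_pvm_integral_const G \<psi>i) auto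
      then show "has_pvm_integral G (\<lambda>x. \<phi> (\<sigma>s i x)) (I G i)"
        using R(1) by (simp add: \<psi>_def)
    qed
    \<comment> \<open>A real supremum dominates its members only when the set is bounded above,
      which compactness provides.\<close>
    have le: "norm (pvm_integral E (\<lambda>x. complex_of_real (\<psi> i x)) -
        pvm_integral F (\<lambda>x. complex_of_real (\<psi> i x))) \<le> pvm_dist E F" if "i < N" for i
      unfolding pvm_dist_def by (rule cSUP_upper[OF \<psi>[OF that] bdd_above_pvm_dist[OF X E F]])
    have "norm (amplify (\<lambda>i. I E i - I F i)) \<le> R * pvm_dist E F"
    proof (rule norm_amplify_le)
      show "norm (I E i - I F i) \<le> R * pvm_dist E F" if "i < N" for i
        using mult_left_mono[OF le[OF that], of R] R(1)
        by (simp add: I_def flip: scaleR_diff_right)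
      \<comment> \<open>The competitor at index 0 witnesses that the supremum is
        nonnegative.\<close>
      show "0 \<le> R * pvm_dist E F"
        using order_trans[OF norm_ge_zero le[OF \<open>0 < N\<close>]] R(1) by simp
    qed
    then show "norm (pvm_integral (pvm_map N \<sigma>s S E) (\<lambda>x. complex_of_real (\<phi> x)) -
        pvm_integral (pvm_map N \<sigma>s S F) (\<lambda>x. complex_of_real (\<phi> x))) \<le> R * pvm_dist E F"
      by (simp add: I E F amplify_diff)
  qed
  moreover have "pvm_map N \<sigma>s S \<in> projection_valued_measures \<rightarrow> projection_valued_measures"
    using pvm_map_in_pvm[OF \<sigma>s] by auto
  ultimately show ?thesis
    unfolding lipschitz_contraction_def using R by blast
qed

end
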